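(* The randomized competitive ratio of Weighted $k$-Server -- Revealed Service Pattern (W$k$S-RSP) on uniform metrics is $\Omega(2^k)$: there is an absolute constant $c>0$ such that for every $k\ge 1$ there exist server weights and a finite uniform metric space for which no randomized online algorithm for W$k$S-RSP is $\alpha$-competitive with $\alpha< c\cdot 2^k$.
   Context: Uniform metric: a finite set $U$ of points, every two distinct points at distance $1$. There are $k$ servers, server $i$ has weight $w_i$ with $w_1\le\dots\le w_k$; the cost of a solution is $\sum_i w_i\cdot(\text{number of moves of server } i)$. A (hierarchical) service pattern over $[1,T+1)$ is a $k$-tuple $\mathcal I=(\mathcal I^1,\dots,\mathcal I^k)$ where each level $\mathcal I^\ell$ is a partition of $[1,T+1)$ into left-closed right-open intervals with integer endpoints, and $\mathcal I^\ell$ refines $\mathcal I^{\ell+1}$ for each $\ell<k$. Its cost is $\sum_\ell w_\ell|\mathcal I^\ell|$. A labeling is a function from the multiset $\mathcal I^1\uplus\dots\uplus\mathcal I^k$ to $U$; it is feasible with respect to $(\sigma_1,\dots,\sigma_T)$ if for each $t$ some interval containing $t$ is labeled $\sigma_t$; a pattern is feasible if it has a feasible labeling. The $\ell$-extension of a pattern $\mathcal I_{t-1}$ over $[1,t)$ is the pattern over $[1,t+1)$ obtained by adding $[t,t+1)$ as a new interval to each level $i\le\ell$ and extending the last interval of each level $i>\ell$ by $[t,t+1)$. W$k$S-RSP: in round $t$ the online algorithm receives $(\sigma_t,\ell_t)$, with the guarantee that the revealed pattern $\mathcal I_t$ (the $\ell_t$-extension of $\mathcal I_{t-1}$) is feasible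 with respect to $(\sigma_1,\dots,\sigma_t)$; it must move its servers so that some server is at $\sigma_t$. A randomized algorithm is $\alpha$-competitive if on every input its expected cost is at most $\alpha$ times the cost of the final revealed pattern plus an additive constant independent of the input. *)

theory Defs
  imports "HOL-Probability.Probability"
begin

text \<open>
  Servers and levels are indexed by \<open>1, \<dots>, k\<close>. The half-open interval \<open>[a, b)\<close> with
  integer end points is represented by the set \<open>{a..<b}\<close> of the rounds it contains, and a
  \<open>k\<close>-tuple of levels by a function on \<open>nat\<close> of which only the values on \<open>{1..k}\<close> matter.
\<close>

type_synonym pattern = "nat \<Rightarrow> nat set set"

definition service_pattern :: "nat \<Rightarrow> nat \<Rightarrow> pattern \<Rightarrow> bool" where
  "service_pattern k T I \<longleftrightarrow>
     (\<forall>l\<in>{1..k}. partition_on {1..<T + 1} (I l) \<and> (\<forall>J\<in>I l. \<exists>a b. J = {a..<b})) \<and>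
     (\<forall>l\<in>{1..<k}. refines {1..<T + 1} (I l) (I (l + 1)))"

definition pattern_cost :: "nat \<Rightarrow> (nat \<Rightarrow> real) \<Rightarrow> pattern \<Rightarrow> real" where
  "pattern_cost k w I = (\<Sum>l = 1..k. w l * real (card (I l)))"

text \<open>
  A labeling takes the level as an additional argument: an interval occurring on several levels
  carries an independent label on each of them (disjoint union of the levels).
\<close>

definition labeling :: "nat \<Rightarrow> 'p set \<Rightarrow> pattern \<Rightarrow> (nat \<Rightarrow> nat set \<Rightarrow> 'p) \<Rightarrow> bool" where
  "labeling k U I g \<longleftrightarrow> (\<forall>l\<in>{1..k}. \<forall>J\<in>I l. g l J \<in> U)"

definition feasible_labeling ::
    "nat \<Rightarrow> nat \<Rightarrow> pattern \<Rightarrow> (nat \<Rightarrow> 'p) \<Rightarrow> (nat \<Rightarrow> nat set \<Rightarrow> 'p) \<Rightarrow> bool" where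
  "feasible_labeling k T I \<sigma> g \<longleftrightarrow>
     (\<forall>t\<in>{1..T}. \<exists>l\<in>{1..k}. \<exists>J\<in>I l. t \<in> J \<and> g l J = \<sigma> t)"

definition feasible_pattern ::
    "nat \<Rightarrow> 'p set \<Rightarrow> nat \<Rightarrow> pattern \<Rightarrow> (nat \<Rightarrow> 'p) \<Rightarrow> bool" where
  "feasible_pattern k U T I \<sigma> \<longleftrightarrow>
     (\<exists>g. labeling k U I g \<and> feasible_labeling k T I \<sigma> g)"

text \<open>
  For a pattern over \<open>[1, t)\<close>, the last interval of a level is the one containing \<open>t - 1\<close>.
\<close>

definition extension :: "nat \<Rightarrow> nat \<Rightarrow> pattern \<Rightarrow> pattern" where
  "extension l t I = (\<lambda>i. if i \<le> l then insert {t..<t + 1} (I i)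
     else (\<lambda>J. if t - 1 \<in> J then J \<union> {t..<t + 1} else J) ` I i)"

text \<open>
  An input is a list of pairs \<open>(\<sigma>\<^sub>t, \<ell>\<^sub>t)\<close>; round \<open>t\<close> is the list entry with index \<open>t - 1\<close>.
\<close>

type_synonym 'p input = "('p \<times> nat) list"

primrec revealed_pattern :: "'p input \<Rightarrow> nat \<Rightarrow> pattern" where
  "revealed_pattern \<rho> 0 = (\<lambda>_. {})"
| "revealed_pattern \<rho> (Suc t) = extension (snd (\<rho> ! t)) (Suc t) (revealed_pattern \<rho> t)"

text \<open>
  The empty pattern over \<open>[1, 1)\<close> has no intervals that could be extended, so the requirement
  that the revealed objects are service patterns amounts to \<open>\<ell>\<^sub>1 = k\<close>.
\<close>

definition valid_input :: "nat \<Rightarrow> 'p set \<Rightarrow> 'p input \<Rightarrow> bool" where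
  "valid_input k U \<rho> \<longleftrightarrow>
     (\<forall>t\<in>{1..length \<rho>}. fst (\<rho> ! (t - 1)) \<in> U \<and> snd (\<rho> ! (t - 1)) \<le> k \<and>
        service_pattern k t (revealed_pattern \<rho> t) \<and>
        feasible_pattern k U t (revealed_pattern \<rho> t) (\<lambda>s. fst (\<rho> ! (s - 1))))"

text \<open>
  A deterministic online algorithm maps the history up to and including the current round to the
  positions of the servers at the end of that round; its value on \<open>[]\<close> is the initial
  configuration.
\<close>

type_synonym 'p algorithm = "'p input \<Rightarrow> nat \<Rightarrow> 'p"

definition online_algorithm :: "nat \<Rightarrow> 'p set \<Rightarrow> 'p algorithm \<Rightarrow> bool" where
  "online_algorithm k U A \<longleftrightarrow>
     (\<forall>\<rho>. valid_input k U \<rho> \<longrightarrow>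
        (\<forall>i\<in>{1..k}. A \<rho> i \<in> U) \<and>
        (\<rho> \<noteq> [] \<longrightarrow> (\<exists>i\<in>{1..k}. A \<rho> i = fst (last \<rho>))))"

definition moves :: "'p algorithm \<Rightarrow> 'p input \<Rightarrow> nat \<Rightarrow> nat" where
  "moves A \<rho> i = card {t\<in>{1..length \<rho>}. A (take t \<rho>) i \<noteq> A (take (t - 1) \<rho>) i}"

definition algorithm_cost :: "nat \<Rightarrow> (nat \<Rightarrow> real) \<Rightarrow> 'p algorithm \<Rightarrow> 'p input \<Rightarrow> real" where
  "algorithm_cost k w A \<rho> = (\<Sum>i = 1..k. w i * real (moves A \<rho> i))"

text \<open>
  A randomized online algorithm is a probability distribution over deterministic ones for which
  the position of every server after every valid history is a random variable.
\<close>

definition randomized_algorithm :: "nat \<Rightarrow> 'p set \<Rightarrow> 'p algorithm measure \<Rightarrow> bool" where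
  "randomized_algorithm k U M \<longleftrightarrow>
     prob_space M \<and> (\<forall>A\<in>space M. online_algorithm k U A) \<and>
     (\<forall>\<rho>. valid_input k U \<rho> \<longrightarrow>
        (\<forall>i\<in>{1..k}. (\<lambda>A. A \<rho> i) \<in> measurable M (count_space UNIV)))"

definition competitive ::
    "nat \<Rightarrow> (nat \<Rightarrow> real) \<Rightarrow> 'p set \<Rightarrow> real \<Rightarrow> 'p algorithm measure \<Rightarrow> bool" where
  "competitive k w U \<alpha> M \<longleftrightarrow>
     (\<exists>b. \<forall>\<rho>. valid_input k U \<rho> \<longrightarrow>
        (LINT A|M. algorithm_cost k w A \<rho>) \<le>
          \<alpha> * pattern_cost k w (revealed_pattern \<rho> (length \<rho>)) + b)"

end

theory Submission
  imports Defs
begin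

text \<open>
  The weights are \<open>w\<^sub>l = D\<^sup>l\<close> for a large \<open>D\<close>. An attack of level \<open>l\<close> on a set \<open>P\<close> of \<open>n\<^sub>l\<close> points is
  a request sequence which is cheap for the revealed pattern if some interval above level \<open>l\<close> has
  its label in \<open>P\<close>, but costs an algorithm \<open>w\<^sub>l\<^sub>+\<^sub>1 / 2\<close> in expectation if it has no server above \<open>l\<close>
  in \<open>P\<close>. It consists of many attacks of level \<open>l - 1\<close> on members of a covering of \<open>P\<close>, a family of
  subsets of size \<open>n\<^sub>l\<^sub>-\<^sub>1\<close> such that every point is missed by some member, while every \<open>p\<close> in \<open>P\<close>
  has a companion \<open>q\<close> such that all members contain \<open>p\<close> or \<open>q\<close>: a suitable member misses server
  \<open>l\<close> with probability at least \<open>1 / (n\<^sub>l\<^sub>-\<^sub>1 + 1)\<close> each time, whereas the label \<open>q\<close> on level \<open>l\<close>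
  serves all attacks. Coverings exist with \<open>n\<^sub>l\<close> about \<open>n\<^sub>l\<^sub>-\<^sub>1\<^sup>2 / 4\<close>, so \<open>n\<^sub>l\<close> is doubly exponential.
  Finally, in each phase an interval of level \<open>k\<close> hides its label among up to \<open>2 n\<^sub>k\<^sub>-\<^sub>1\<close> points, and
  attacks of level \<open>k - 1\<close> halve the set of candidates, each time missing server \<open>k\<close> with probability
  \<open>1/2\<close>. This forces a cost of order \<open>w\<^sub>k log n\<^sub>k\<^sub>-\<^sub>1\<close>, that is \<open>2\<^sup>k w\<^sub>k\<close>, against a pattern cost of at
  most \<open>3 w\<^sub>k\<close>.

  The adversary is oblivious but knows the distribution of the algorithm, so it can choose each
  subset deterministically as the one which the relevant server misses with the largest probability.
\<close>

section \<open>Revealed patterns are service patterns\<close>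

definition adjoin :: "'a \<Rightarrow> 'a \<Rightarrow> 'a set \<Rightarrow> 'a set" where
  "adjoin a x J = (if a \<in> J then insert x J else J)"

lemma subset_adjoin: "J \<subseteq> adjoin a x J"
  by (auto simp: adjoin_def)

lemma adjoin_mono: "J \<subseteq> J' \<Longrightarrow> adjoin a x J \<subseteq> adjoin a x J'"
  by (auto simp: adjoin_def)

lemma partition_on_insert_singleton:
  assumes "partition_on A P" "x \<notin> A"
  shows "partition_on (insert x A) (insert {x} P)"
  using assms by (subst partition_on_insert) (auto simp: partition_on_def disjnt_def)

lemma partition_on_adjoin:
  assumes P: "partition_on A P" and "a \<in> A" "x \<notin> A"
  shows "partition_on (insert x A) (adjoin a x ` P)"
proof (rule partition_onI)
  show "\<Union> (adjoin a x ` P) = insert x A"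
    using partition_onD1[OF P] \<open>a \<in> A\<close> by (auto simp: adjoin_def)
  show "{} \<notin> adjoin a x ` P"
    using partition_onD3[OF P] by (auto simp: adjoin_def)
  fix p q assume "p \<in> adjoin a x ` P" "q \<in> adjoin a x ` P" "p \<noteq> q"
  then obtain p' q' where pq: "p' \<in> P" "q' \<in> P" "p = adjoin a x p'" "q = adjoin a x q'" "p' \<noteq> q'"
    by blast
  then have "p' \<inter> q' = {}" "x \<notin> p'" "x \<notin> q'"
    using partition_onD2[OF P] partition_onD1[OF P] \<open>x \<notin> A\<close> by (auto dest: disjointD)
  then show "disjnt p q"
    using pq(3,4) by (auto simp: adjoin_def disjnt_def)
qed

lemma refines_insert_singleton:
  assumes "refines A P Q" "x \<notin> A"
  shows "refines (insert x A) (insert {x} P) (insert {x} Q)"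
  using assms by (auto simp: refines_def partition_on_insert_singleton)

lemma refines_insert_singleton_adjoin:
  assumes ref: "refines A P Q" and "a \<in> A" "x \<notin> A"
  shows "refines (insert x A) (insert {x} P) (adjoin a x ` Q)"
proof -
  obtain L where L: "L \<in> Q" "a \<in> L"
    using ref \<open>a \<in> A\<close> unfolding refines_def partition_on_def by blast
  then have "x \<in> adjoin a x L"
    by (simp add: adjoin_def)
  with L(1) have "\<exists>Y\<in>adjoin a x ` Q. {x} \<subseteq> Y"
    by blast
  moreover have "\<exists>Y\<in>adjoin a x ` Q. X \<subseteq> Y" if "X \<in> P" for X
    using ref that subset_adjoin unfolding refines_def by (metis imageI order.trans)
  ultimately show ?thesis
    using ref assms(2,3)
    by (simp add: refines_def partition_on_insert_singleton partition_on_adjoin)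
qed

lemma refines_adjoin:
  assumes "refines A P Q" "a \<in> A" "x \<notin> A"
  shows "refines (insert x A) (adjoin a x ` P) (adjoin a x ` Q)"
proof -
  have "\<exists>Y\<in>adjoin a x ` Q. adjoin a x X \<subseteq> Y" if "X \<in> P" for X
    using assms(1) that adjoin_mono unfolding refines_def by (metis imageI)
  then show ?thesis
    using assms by (simp add: refines_def partition_on_adjoin)
qed

lemma interval_adjoin_Suc:
  assumes "{a..<b} \<subseteq> {1..<Suc t}"
  shows "\<exists>a' b'. adjoin t (Suc t) {a..<b} = {a'..<b'}"
proof (cases "t \<in> {a..<b}")
  case True
  then have "b = Suc t"
    using assms by (auto simp: atLeastLessThan_subset_iff)
  then have "adjoin t (Suc t) {a..<b} = {a..<Suc (Suc t)}"
    using True by (auto simp: adjoin_def)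
  then show ?thesis by blast
qed (auto simp: adjoin_def)

lemma extension_Suc:
  "extension l (Suc t) I i = (if i \<le> l then insert {Suc t} (I i) else adjoin t (Suc t) ` I i)"
  by (auto simp: extension_def adjoin_def)

lemma partition_on_extension:
  assumes "partition_on {1..<t + 1} (I i)" "i \<le> l \<or> t \<noteq> 0"
  shows "partition_on {1..<Suc t + 1} (extension l (Suc t) I i)"
proof -
  have "{1..<Suc t + 1} = insert (Suc t) {1..<t + 1}" by auto
  then show ?thesis
    using assms by (auto simp: extension_Suc intro: partition_on_insert_singleton partition_on_adjoin)
qed

lemma interval_extension:
  assumes part: "partition_on {1..<t + 1} (I i)" and int: "\<And>J. J \<in> I i \<Longrightarrow> \<exists>a b. J = {a..<b}"
    and J: "J \<in> extension l (Suc t) I i"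
  shows "\<exists>a b. J = {a..<b}"
proof (cases "i \<le> l")
  case True
  then have "J = {Suc t..<Suc (Suc t)} \<or> J \<in> I i" using J by (simp add: extension_Suc)
  then show ?thesis using int by blast
next
  case False
  then obtain J' where J': "J' \<in> I i" "J = adjoin t (Suc t) J'"
    using J by (auto simp: extension_Suc)
  then obtain a b where "J' = {a..<b}" using int by blast
  moreover have "J' \<subseteq> {1..<Suc t}" using part J'(1) by (auto simp: partition_on_def)
  ultimately show ?thesis using interval_adjoin_Suc J'(2) by blast
qed

lemma refines_extension:
  assumes ref: "refines {1..<t + 1} (I i) (I (i + 1))" and "i + 1 \<le> l \<or> t \<noteq> 0"
  shows "refines {1..<Suc t + 1} (extension l (Suc t) I i) (extension l (Suc t) I (i + 1))"
proof -
  have rounds: "{1..<Suc t + 1} = insert (Suc t) {1..<t + 1}" "Suc t \<notin> {1..<t + 1}" by auto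
  have last: "t \<in> {1..<t + 1}" if "t \<noteq> 0" using that by auto
  show ?thesis
    unfolding rounds(1) extension_Suc
    using assms(2) last refines_insert_singleton[OF ref rounds(2)]
      refines_insert_singleton_adjoin[OF ref _ rounds(2)] refines_adjoin[OF ref _ rounds(2)]
    by (cases "i + 1 \<le> l"; cases "i \<le> l") simp_all
qed

lemma service_pattern_extension:
  assumes I: "service_pattern k t I" and first: "t = 0 \<Longrightarrow> l = k"
  shows "service_pattern k (Suc t) (extension l (Suc t) I)"
proof -
  have part: "partition_on {1..<t + 1} (I i)" and int: "\<And>J. J \<in> I i \<Longrightarrow> \<exists>a b. J = {a..<b}"
    and last: "i \<le> l \<or> t \<noteq> 0" if "i \<in> {1..k}" for i
    using I first that by (auto simp: service_pattern_def)
  have "partition_on {1..<Suc t + 1} (extension l (Suc t) I i)" if "i \<in> {1..k}" for i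
    using part[OF that] last[OF that] by (rule partition_on_extension)
  moreover have "\<exists>a b. J = {a..<b}" if "i \<in> {1..k}" "J \<in> extension l (Suc t) I i" for i J
    using interval_extension[of t I i J l] part int that by blast
  moreover have "refines {1..<Suc t + 1} (extension l (Suc t) I i) (extension l (Suc t) I (i + 1))"
    if "i \<in> {1..<k}" for i
    using I that last[of "i + 1"] by (intro refines_extension) (auto simp: service_pattern_def)
  ultimately show ?thesis
    unfolding service_pattern_def by blast
qed

lemma revealed_pattern_append:
  "t \<le> length \<rho> \<Longrightarrow> revealed_pattern (\<rho> @ \<rho>') t = revealed_pattern \<rho> t"
  by (induction t) (simp_all add: nth_append)

abbreviation final_pattern :: "'p input \<Rightarrow> pattern" where
  "final_pattern \<rho> \<equiv> revealed_pattern \<rho> (length \<rho>)"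

lemma final_pattern_snoc:
  "final_pattern (\<rho> @ [r]) = extension (snd r) (Suc (length \<rho>)) (final_pattern \<rho>)"
  by (simp add: revealed_pattern_append)

lemma service_pattern_final:
  "(\<rho> \<noteq> [] \<Longrightarrow> snd (hd \<rho>) = k) \<Longrightarrow> service_pattern k (length \<rho>) (final_pattern \<rho>)"
proof (induction \<rho> rule: rev_induct)
  case Nil
  then show ?case by (simp add: service_pattern_def refines_def partition_on_empty)
next
  case (snoc r \<rho>)
  then have "service_pattern k (length \<rho>) (final_pattern \<rho>)"
    by (cases "\<rho> = []") auto
  moreover have "snd r = k" if "length \<rho> = 0"
    using snoc.prems that by simp
  ultimately show ?case
    unfolding final_pattern_snoc unfolding length_append_singleton
    by (rule service_pattern_extension)
qed

section \<open>Feasibility of revealed patterns\<close>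

text \<open>
  A configuration \<open>f\<close> gives the label of the current interval on each level; the round \<open>(x, l)\<close>
  allows it to change on the levels up to \<open>l\<close> only.
\<close>

primrec serves :: "nat \<Rightarrow> (nat \<Rightarrow> 'p) \<Rightarrow> 'p input \<Rightarrow> (nat \<Rightarrow> 'p) \<Rightarrow> bool" where
  "serves k f [] f' \<longleftrightarrow> f' = f"
| "serves k f (r # s) f' \<longleftrightarrow>
     (\<exists>g. (\<forall>i. snd r < i \<longrightarrow> g i = f i) \<and> fst r \<in> g ` {1..k} \<and> serves k g s f')"

lemma serves_append:
  "serves k f (s @ t) f'' \<longleftrightarrow> (\<exists>f'. serves k f s f' \<and> serves k f' t f'')"
  by (induction s arbitrary: f) auto

lemma serves_imp_configurations:
  assumes "serves k f \<rho> f'"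
  shows "\<exists>g. g 0 = f \<and> (\<forall>t<length \<rho>. fst (\<rho> ! t) \<in> g (Suc t) ` {1..k} \<and>
    (\<forall>i>snd (\<rho> ! t). g (Suc t) i = g t i))"
  using assms
proof (induction \<rho> arbitrary: f)
  case Nil
  then show ?case by auto
next
  case (Cons r \<rho>)
  from Cons.prems obtain f\<^sub>1
    where f\<^sub>1: "\<forall>i>snd r. f\<^sub>1 i = f i" "fst r \<in> f\<^sub>1 ` {1..k}" "serves k f\<^sub>1 \<rho> f'" by auto
  from Cons.IH[OF f\<^sub>1(3)] obtain g
    where "g 0 = f\<^sub>1" "\<forall>t<length \<rho>. fst (\<rho> ! t) \<in> g (Suc t) ` {1..k} \<and>
      (\<forall>i>snd (\<rho> ! t). g (Suc t) i = g t i)" by blast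
  then show ?case
    using f\<^sub>1(1,2) by (intro exI[of _ "case_nat f g"]) (auto simp: less_Suc_eq_0_disj)
qed

lemma configuration_constant_on_interval:
  assumes "\<And>t i. t < T \<Longrightarrow> snd (\<rho> ! t) < i \<Longrightarrow> g (Suc t) i = g t i"
    and "J \<in> revealed_pattern \<rho> T l" "s \<in> J" "s' \<in> J"
  shows "g s l = g s' l"
  using assms
proof (induction T arbitrary: J s s')
  case (Suc T)
  have IH: "g s l = g s' l" if "J \<in> revealed_pattern \<rho> T l" "s \<in> J" "s' \<in> J" for J s s'
    using Suc.IH[OF _ that] Suc.prems(1) less_SucI by blast
  show ?case
  proof (cases "l \<le> snd (\<rho> ! T)")
    case True
    then consider "J = {Suc T}" | "J \<in> revealed_pattern \<rho> T l"
      using Suc.prems(2) by (auto simp: extension_Suc)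
    then show ?thesis
      using Suc.prems(3,4) by cases (auto intro: IH)
  next
    case False
    then obtain J' where J': "J' \<in> revealed_pattern \<rho> T l" "J = adjoin T (Suc T) J'"
      using Suc.prems(2) by (auto simp: extension_Suc)
    have last: "g (Suc T) l = g T l" using Suc.prems(1) False by simp
    show ?thesis
    proof (cases "T \<in> J'")
      case True
      then have "g x l = g T l" if "x \<in> J" for x
        using that last J'(2) IH[OF J'(1) _ True, of x] by (auto simp: adjoin_def)
      then show ?thesis using Suc.prems(3,4) by metis
    next
      case False
      then have "J = J'" using J'(2) by (simp add: adjoin_def)
      then show ?thesis using IH J'(1) Suc.prems(3,4) by blast
    qed
  qed
qed simp

lemma feasible_patternI:
  assumes g: "feasible_labeling k T I \<sigma> g" and "\<sigma> ` {1..T} \<subseteq> U" "x \<in> U"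
  shows "feasible_pattern k U T I \<sigma>"
proof -
  let ?g = "\<lambda>l J. if g l J \<in> U then g l J else x"
  have "labeling k U I ?g"
    using \<open>x \<in> U\<close> by (simp add: labeling_def)
  moreover have "feasible_labeling k T I \<sigma> ?g"
    using g \<open>\<sigma> ` _ \<subseteq> U\<close> unfolding feasible_labeling_def image_subset_iff by metis
  ultimately show ?thesis
    unfolding feasible_pattern_def by blast
qed

abbreviation request :: "'p input \<Rightarrow> nat \<Rightarrow> 'p" where
  "request \<rho> \<equiv> \<lambda>s. fst (\<rho> ! (s - 1))"

lemma serves_imp_feasible_labeling:
  assumes serv: "serves k f \<rho> f'" and part: "service_pattern k (length \<rho>) (final_pattern \<rho>)"
  shows "\<exists>g. feasible_labeling k (length \<rho>) (final_pattern \<rho>) (request \<rho>) g"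
proof -
  from serves_imp_configurations[OF serv] obtain g
    where g: "\<And>t. t < length \<rho> \<Longrightarrow> fst (\<rho> ! t) \<in> g (Suc t) ` {1..k}"
      "\<And>t i. t < length \<rho> \<Longrightarrow> snd (\<rho> ! t) < i \<Longrightarrow> g (Suc t) i = g t i" by blast
  have "\<exists>l\<in>{1..k}. \<exists>J\<in>final_pattern \<rho> l. t \<in> J \<and> g (SOME s. s \<in> J) l = request \<rho> t"
    if t: "t \<in> {1..length \<rho>}" for t
  proof -
    obtain l where l: "l \<in> {1..k}" "g t l = request \<rho> t"
      using g(1)[of "t - 1"] t by (cases t) auto
    have "t \<in> \<Union> (final_pattern \<rho> l)"
      using part l(1) t by (auto simp: service_pattern_def partition_on_def)
    then obtain J where J: "J \<in> final_pattern \<rho> l" "t \<in> J" by blast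
    have "(SOME s. s \<in> J) \<in> J" using J(2) by (rule someI)
    with J have "g (SOME s. s \<in> J) l = g t l"
      using configuration_constant_on_interval[of "length \<rho>" \<rho> g] g(2) by blast
    then show ?thesis using l J by auto
  qed
  then show ?thesis
    unfolding feasible_labeling_def by (intro exI[of _ "\<lambda>l J. g (SOME s. s \<in> J) l"]) blast
qed

definition servable :: "nat \<Rightarrow> 'p set \<Rightarrow> 'p input \<Rightarrow> bool" where
  "servable k U \<rho> \<longleftrightarrow> (\<exists>f f'. serves k f \<rho> f') \<and> (\<rho> \<noteq> [] \<longrightarrow> snd (hd \<rho>) = k) \<and>
     (\<forall>r\<in>set \<rho>. fst r \<in> U \<and> snd r \<le> k)"

lemma servable_Nil: "servable k U []"
  by (simp add: servable_def)

lemma servable_appendD: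
  assumes "servable k U (\<rho> @ s)"
  shows "servable k U \<rho>"
  using assms by (cases "\<rho> = []") (auto simp: servable_def serves_append)

lemma valid_input_Nil: "valid_input k U []"
  by (simp add: valid_input_def)

lemma feasible_pattern_cong:
  assumes "\<And>t. t \<in> {1..T} \<Longrightarrow> \<sigma> t = \<sigma>' t"
  shows "feasible_pattern k U T I \<sigma> \<longleftrightarrow> feasible_pattern k U T I \<sigma>'"
  using assms by (simp add: feasible_pattern_def feasible_labeling_def)

lemma valid_input_snoc:
  "valid_input k U (\<rho> @ [r]) \<longleftrightarrow> valid_input k U \<rho> \<and> fst r \<in> U \<and> snd r \<le> k \<and>
     service_pattern k (length (\<rho> @ [r])) (final_pattern (\<rho> @ [r])) \<and>
     feasible_pattern k U (length (\<rho> @ [r])) (final_pattern (\<rho> @ [r])) (request (\<rho> @ [r]))"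
proof -
  have prefix: "(\<rho> @ [r]) ! (t - 1) = \<rho> ! (t - 1)"
      "revealed_pattern (\<rho> @ [r]) t = revealed_pattern \<rho> t"
    if "t \<in> {1..length \<rho>}" for t
    using that by (auto simp: nth_append revealed_pattern_append)
  have feasible: "feasible_pattern k U t I (request (\<rho> @ [r])) \<longleftrightarrow>
      feasible_pattern k U t I (request \<rho>)"
    if "t \<in> {1..length \<rho>}" for t I
    by (rule feasible_pattern_cong) (use that in \<open>auto simp: nth_append\<close>)
  have "{1..length (\<rho> @ [r])} = insert (Suc (length \<rho>)) {1..length \<rho>}" by auto
  then show ?thesis
    unfolding valid_input_def using prefix feasible by (simp del: revealed_pattern.simps) blast
qed

lemma valid_input_appendD:
  assumes "valid_input k U (\<rho> @ s)"
  shows "valid_input k U \<rho>"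
  using assms by (induction s rule: rev_induct) (simp_all add: valid_input_snoc flip: append_assoc)

lemma servable_imp_valid_input:
  "servable k U \<rho> \<Longrightarrow> valid_input k U \<rho>"
proof (induction \<rho> rule: rev_induct)
  case Nil
  show ?case by (rule valid_input_Nil)
next
  case (snoc r \<rho>)
  let ?\<rho> = "\<rho> @ [r]"
  from snoc.prems obtain f f' where "serves k f ?\<rho> f'"
    by (auto simp: servable_def)
  moreover have service: "service_pattern k (length ?\<rho>) (final_pattern ?\<rho>)"
    using snoc.prems by (intro service_pattern_final) (simp add: servable_def)
  ultimately obtain g where "feasible_labeling k (length ?\<rho>) (final_pattern ?\<rho>) (request ?\<rho>) g"
    using serves_imp_feasible_labeling by blast
  moreover have "request ?\<rho> ` {1..length ?\<rho>} \<subseteq> U"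
  proof (intro image_subsetI)
    fix t assume "t \<in> {1..length ?\<rho>}"
    then have "?\<rho> ! (t - 1) \<in> set ?\<rho>" by (intro nth_mem) auto
    then show "request ?\<rho> t \<in> U" using snoc.prems unfolding servable_def by blast
  qed
  moreover have r: "fst r \<in> U" "snd r \<le> k"
    using snoc.prems by (simp_all add: servable_def)
  ultimately have "feasible_pattern k U (length ?\<rho>) (final_pattern ?\<rho>) (request ?\<rho>)"
    by (intro feasible_patternI)
  then show ?case
    unfolding valid_input_snoc using snoc.IH[OF servable_appendD[OF snoc.prems]] service r by blast
qed

section \<open>The cost of revealed patterns\<close>

definition reveal_cost :: "(nat \<Rightarrow> real) \<Rightarrow> 'p input \<Rightarrow> real" where
  "reveal_cost w s = (\<Sum>r\<leftarrow>s. \<Sum>l = 1..snd r. w l)"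

lemma reveal_cost_simps [simp]:
  "reveal_cost w [] = 0"
  "reveal_cost w (r # s) = (\<Sum>l = 1..snd r. w l) + reveal_cost w s"
  "reveal_cost w (s @ t) = reveal_cost w s + reveal_cost w t"
  by (simp_all add: reveal_cost_def)

lemma card_extension_le:
  assumes "finite (I i)"
  shows "card (extension l t I i) \<le> card (I i) + of_bool (i \<le> l)"
proof (cases "i \<le> l")
  case False
  then show ?thesis
    unfolding extension_def by (simp only: if_False of_bool_eq add_0_right card_image_le[OF assms])
qed (use assms in \<open>simp add: extension_def card_insert_if\<close>)

lemma pattern_cost_extension_le:
  assumes fin: "\<And>i. i \<in> {1..k} \<Longrightarrow> finite (I i)" and "l \<le> k" and w: "\<And>i. i \<in> {1..k} \<Longrightarrow> 0 \<le> w i"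
  shows "pattern_cost k w (extension l t I) \<le> pattern_cost k w I + (\<Sum>i = 1..l. w i)"
proof -
  have "real (card (extension l t I i)) \<le> real (card (I i)) + of_bool (i \<le> l)" if "i \<in> {1..k}" for i
    using card_extension_le[of I i l t, OF fin[OF that]]
    by (metis of_nat_add of_nat_le_iff of_nat_of_bool)
  then have "pattern_cost k w (extension l t I) \<le>
      (\<Sum>i = 1..k. w i * (real (card (I i)) + of_bool (i \<le> l)))"
    unfolding pattern_cost_def using w by (intro sum_mono mult_left_mono) auto
  also have "\<dots> = pattern_cost k w I + (\<Sum>i = 1..k. w i * of_bool (i \<le> l))"
    by (simp add: pattern_cost_def distrib_left sum.distrib)
  also have "(\<Sum>i = 1..k. w i * of_bool (i \<le> l)) = (\<Sum>i = 1..l. w i)"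
    using \<open>l \<le> k\<close> by (intro sum.mono_neutral_cong_right) auto
  finally show ?thesis .
qed

lemma finite_service_pattern:
  assumes "service_pattern k T I" "i \<in> {1..k}"
  shows "finite (I i)"
  using assms by (auto simp: service_pattern_def intro: finite_elements[of "{1..<T + 1}"])

lemma pattern_cost_final_le_reveal_cost:
  assumes "valid_input k U \<rho>" and w: "\<And>i. i \<in> {1..k} \<Longrightarrow> 0 \<le> w i"
  shows "pattern_cost k w (final_pattern \<rho>) \<le> reveal_cost w \<rho>"
  using assms(1)
proof (induction \<rho> rule: rev_induct)
  case Nil
  then show ?case by (simp add: pattern_cost_def)
next
  case (snoc r \<rho>)
  then have "valid_input k U \<rho>" "snd r \<le> k"
    by (simp_all add: valid_input_snoc)
  have "finite (final_pattern \<rho> i)" if "i \<in> {1..k}" for i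
  proof (cases "\<rho> = []")
    case False
    then have "service_pattern k (length \<rho>) (final_pattern \<rho>)"
      using \<open>valid_input k U \<rho>\<close> by (auto simp: valid_input_def Suc_le_eq)
    then show ?thesis using that by (rule finite_service_pattern)
  qed simp
  then have "pattern_cost k w (final_pattern (\<rho> @ [r])) \<le>
      pattern_cost k w (final_pattern \<rho>) + (\<Sum>i = 1..snd r. w i)"
    unfolding final_pattern_snoc using \<open>snd r \<le> k\<close> w by (intro pattern_cost_extension_le)
  also have "\<dots> \<le> reveal_cost w (\<rho> @ [r])"
    using snoc.IH[OF \<open>valid_input k U \<rho>\<close>] by simp
  finally show ?case .
qed

section \<open>Coverings\<close>

definition covering :: "nat \<Rightarrow> 'p set \<Rightarrow> 'p set set \<Rightarrow> bool" where
  "covering n P \<Q> \<longleftrightarrow>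
     finite \<Q> \<and> card \<Q> \<le> n + 1 \<and> (\<forall>Q\<in>\<Q>. Q \<subseteq> P \<and> card Q = n) \<and>
     (\<forall>x. \<exists>Q\<in>\<Q>. x \<notin> Q) \<and> (\<forall>p\<in>P. \<exists>q. \<forall>Q\<in>\<Q>. p \<in> Q \<or> q \<in> Q)"

lemma coveringD:
  assumes "covering n P \<Q>"
  shows "finite \<Q>" "card \<Q> \<le> n + 1" "\<And>Q. Q \<in> \<Q> \<Longrightarrow> Q \<subseteq> P" "\<And>Q. Q \<in> \<Q> \<Longrightarrow> card Q = n"
    "\<And>x. \<exists>Q\<in>\<Q>. x \<notin> Q" "\<And>p. p \<in> P \<Longrightarrow> \<exists>q. \<forall>Q\<in>\<Q>. p \<in> Q \<or> q \<in> Q"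
  using assms by (simp_all add: covering_def)

lemma covering_image:
  assumes cov: "covering n P \<Q>" and inj: "inj_on e P"
  shows "covering n (e ` P) ((`) e ` \<Q>)"
proof -
  have card: "card (e ` Q) = n" if "Q \<in> \<Q>" for Q
    using coveringD(3,4)[OF cov that] inj by (metis card_image inj_on_subset)
  have miss: "\<exists>Q\<in>\<Q>. x \<notin> e ` Q" for x
  proof (cases "x \<in> e ` P")
    case True
    then obtain p where p: "p \<in> P" "x = e p" by blast
    obtain Q where "Q \<in> \<Q>" "p \<notin> Q" using coveringD(5)[OF cov] by blast
    then show ?thesis
      using inj_on_image_mem_iff[OF inj _ coveringD(3)[OF cov]] p by blast
  next
    case False
    obtain Q where "Q \<in> \<Q>" using coveringD(5)[OF cov] by blast
    then show ?thesis using coveringD(3)[OF cov] False by blast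
  qed
  have pair: "\<exists>q. \<forall>Q\<in>\<Q>. e p \<in> e ` Q \<or> q \<in> e ` Q" if p: "p \<in> P" for p
  proof -
    obtain q where "\<forall>Q\<in>\<Q>. p \<in> Q \<or> q \<in> Q" using coveringD(6)[OF cov p] by blast
    then show ?thesis by (intro exI[of _ "e q"]) blast
  qed
  have "card ((`) e ` \<Q>) \<le> n + 1"
    using card_image_le[OF coveringD(1)[OF cov]] coveringD(2)[OF cov] by (rule order.trans)
  then show ?thesis
    using coveringD(1,3)[OF cov] card miss pair by (simp add: covering_def image_mono)
qed

text \<open>
  A head \<open>(i, 0)\<close> belongs to the sets of all other rows, every other point to the set of its own row
  only. Hence each set contains one of any two heads, and one of a point and the head of its row.
\<close>

definition grid_set :: "nat \<Rightarrow> nat \<Rightarrow> nat \<Rightarrow> (nat \<times> nat) set" where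
  "grid_set a b i = {i} \<times> {1..b} \<union> ({..a} - {i}) \<times> {0}"

lemma covering_grid:
  assumes "a \<ge> 1"
  shows "covering (a + b) ({..a} \<times> {..b}) (grid_set a b ` {..a})"
proof -
  have card: "card (grid_set a b i) = a + b" if "i \<in> {..a}" for i
    unfolding grid_set_def using that by (subst card_Un_disjoint) (auto simp: card_cartesian_product)
  have sub: "grid_set a b i \<subseteq> {..a} \<times> {..b}" if "i \<in> {..a}" for i
    using that by (auto simp: grid_set_def)
  have other: "\<exists>i'\<le>a. i' \<noteq> i" for i
    using assms by (cases "i = 0") (auto intro: exI[of _ 1])
  have miss: "\<exists>i\<in>{..a}. x \<notin> grid_set a b i" for x
  proof (cases x)
    case (Pair i j)
    obtain i' where "i' \<le> a" "i' \<noteq> i" using other by blast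
    then show ?thesis
      using Pair by (cases "i \<le> a \<and> j = 0") (auto simp: grid_set_def)
  qed
  have pair: "\<exists>q. \<forall>i\<in>{..a}. p \<in> grid_set a b i \<or> q \<in> grid_set a b i"
    if p: "p \<in> {..a} \<times> {..b}" for p
  proof -
    obtain i j where ij: "p = (i, j)" "i \<le> a" "j \<le> b" using p by auto
    obtain i' where i': "i' \<le> a" "i' \<noteq> i" using other by blast
    show ?thesis
      by (rule exI[of _ "(if j = 0 then i' else i, 0)"]) (use ij i' in \<open>auto simp: grid_set_def\<close>)
  qed
  have "card (grid_set a b ` {..a}) \<le> a + b + 1"
    using card_image_le[of "{..a}" "grid_set a b"] by simp
  moreover have "\<forall>Q\<in>grid_set a b ` {..a}. Q \<subseteq> {..a} \<times> {..b} \<and> card Q = a + b"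
    using card sub by blast
  ultimately show ?thesis
    unfolding covering_def using miss pair by simp
qed

lemma covering_exists:
  assumes "a \<ge> 1" "card P = (a + 1) * (b + 1)"
  shows "\<exists>\<Q>. covering (a + b) P \<Q>"
proof -
  have "finite P"
    using assms(2) by (intro card_ge_0_finite) simp
  moreover have "card ({..a} \<times> {..b}) = card P"
    using assms(2) by simp
  ultimately obtain e where "bij_betw e ({..a} \<times> {..b}) P"
    using finite_same_card_bij by (metis finite_SigmaI finite_atMost)
  then show ?thesis
    using covering_image[OF covering_grid[OF assms(1), of b], of e] by (auto simp: bij_betw_def)
qed

primrec target_size :: "nat \<Rightarrow> nat" where
  "target_size 0 = 1"
| "target_size (Suc l) = (target_size l - target_size l div 2 + 1) * (target_size l div 2 + 1)"

lemma target_size_pos: "1 \<le> target_size l"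
  by (induction l) auto

lemma covering_target_exists:
  assumes "card P = target_size (Suc l)"
  shows "\<exists>\<Q>. covering (target_size l) P \<Q>"
proof -
  let ?b = "target_size l div 2"
  have "target_size l - ?b \<ge> 1" "(target_size l - ?b) + ?b = target_size l"
    using target_size_pos[of l] by simp_all
  then show ?thesis
    using covering_exists[of "target_size l - ?b" P ?b] assms by simp
qed

lemma target_size_Suc_ge: "(target_size l)\<^sup>2 \<le> 4 * target_size (Suc l)"
proof -
  obtain m where "target_size l = 2 * m \<or> target_size l = 2 * m + 1" by (metis evenE oddE)
  then show ?thesis by (auto simp: power2_eq_square algebra_simps)
qed

lemma target_size_ge: "4 * 2 ^ 2 ^ l \<le> target_size (l + 3)"
proof (induction l)
  case 0
  show ?case by (simp add: numeral_3_eq_3)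
next
  case (Suc l)
  have "4 * (4 * 2 ^ 2 ^ Suc l) = (4 * 2 ^ 2 ^ l :: nat)\<^sup>2"
    by (simp add: power2_eq_square mult_2 power_add)
  also have "\<dots> \<le> (target_size (l + 3))\<^sup>2"
    using Suc.IH by (rule power_mono) simp
  also have "\<dots> \<le> 4 * target_size (Suc l + 3)"
    using target_size_Suc_ge[of "l + 3"] by (simp only: add_Suc)
  finally show ?case by linarith
qed

lemma target_size_ge_double_exponential:
  "2 ^ 2 ^ (k - 4) \<le> 2 * target_size (k - 1)"
proof (cases "k \<ge> 4")
  case True
  then have "k - 1 = k - 4 + 3" by simp
  then have "4 * 2 ^ 2 ^ (k - 4) \<le> target_size (k - 1)"
    using target_size_ge[of "k - 4"] by (simp only:)
  then show ?thesis by linarith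
next
  case False
  then show ?thesis using target_size_pos[of "k - 1"] by simp
qed

section \<open>Attacks\<close>

text \<open>
  In \<open>attack D l l'\<close> and \<open>barrage D l l'\<close>, new intervals start on the levels up to \<open>l'\<close> in the first
  round, and only on those up to \<open>l\<close> at the start of each later attack of level \<open>l\<close>. The number of
  attacks in \<open>attack_Suc\<close> is such that hits of probability \<open>1 / (target_size l + 1)\<close> and expected
  cost \<open>D\<^sup>l\<^sup>+\<^sup>1 / 2\<close> add up to \<open>D\<^sup>l\<^sup>+\<^sup>2\<close>, twice the expected cost that an attack of level \<open>l + 1\<close>
  has to enforce.
\<close>

inductive attack :: "nat \<Rightarrow> nat \<Rightarrow> nat \<Rightarrow> 'p set \<Rightarrow> 'p input \<Rightarrow> bool"
  and barrage :: "nat \<Rightarrow> nat \<Rightarrow> nat \<Rightarrow> 'p set set \<Rightarrow> nat \<Rightarrow> 'p input \<Rightarrow> bool"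
  for D :: nat where
  attack_0: "attack D 0 l' {x} [(x, l')]"
| attack_Suc: "covering (target_size l) P \<Q> \<Longrightarrow>
    barrage D l l' \<Q> (2 * (target_size l + 1) * D) s \<Longrightarrow> attack D (Suc l) l' P s"
| barrage_0: "barrage D l l' \<Q> 0 []"
| barrage_Suc: "barrage D l l' \<Q> m t \<Longrightarrow> Q \<in> \<Q> \<Longrightarrow>
    attack D l (if m = 0 then l' else l) Q s \<Longrightarrow> barrage D l l' \<Q> (Suc m) (t @ s)"

lemma barrage_0_iff: "barrage D l l' \<Q> 0 t \<longleftrightarrow> t = []"
  by (auto elim: barrage.cases intro: barrage_0)

lemma barrage_extend:
  assumes "m \<le> m'" "barrage D l l' \<Q> m t" and "\<And>l'. \<exists>Q\<in>\<Q>. \<exists>s. attack D l l' Q s"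
  shows "\<exists>u. barrage D l l' \<Q> m' (t @ u)"
  using assms(1)
proof (induction m' rule: dec_induct)
  case base
  show ?case using assms(2) by (intro exI[of _ "[]"]) simp
next
  case (step m')
  then show ?case
    using barrage_Suc[of D l l' \<Q> m'] assms(3) by (metis append_assoc)
qed

lemma attack_exists:
  "card P = target_size l \<Longrightarrow> \<exists>s. attack D l l' P s"
proof (induction l arbitrary: l' P)
  case 0
  then show ?case by (auto simp: card_1_singleton_iff intro: attack_0)
next
  case (Suc l)
  from covering_target_exists[OF Suc.prems] obtain \<Q> where cov: "covering (target_size l) P \<Q>" ..
  then have "\<exists>Q\<in>\<Q>. \<exists>s. attack D l l' Q s" for l'
    using coveringD(4,5)[OF cov] Suc.IH by metis
  from barrage_extend[OF le0 barrage_0 this] show ?case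
    using attack_Suc[OF cov] by blast
qed

lemma covering_attack_exists:
  assumes "covering (target_size l) P \<Q>"
  shows "\<exists>Q\<in>\<Q>. \<exists>s. attack D l l' Q s"
  using coveringD(4,5)[OF assms] attack_exists by metis

lemma valid_input_append_barrage:
  assumes cov: "covering (target_size l) P \<Q>"
    and valid: "\<And>s. attack D (Suc l) l' P s \<Longrightarrow> valid_input k U (\<rho> @ s)"
    and t: "barrage D l l' \<Q> m t" and m: "m \<le> 2 * (target_size l + 1) * D"
  shows "valid_input k U (\<rho> @ t)"
proof -
  obtain u where "barrage D l l' \<Q> (2 * (target_size l + 1) * D) (t @ u)"
    using barrage_extend[OF m t covering_attack_exists[OF cov]] by blast
  then have "valid_input k U ((\<rho> @ t) @ u)"
    using valid attack_Suc[OF cov] by simp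
  then show ?thesis by (rule valid_input_appendD)
qed

lemma attack_hd_level:
  fixes P :: "'p set" and \<Q> :: "'p set set"
  assumes "D > 0"
  shows attack_hd: "attack D l l' P s \<Longrightarrow> s \<noteq> [] \<and> snd (hd s) = l'"
    and barrage_hd: "barrage D l l' \<Q> m t \<Longrightarrow> m > 0 \<longrightarrow> t \<noteq> [] \<and> snd (hd t) = l'"
  by (induction rule: attack_barrage.inducts)
    (use assms in \<open>auto simp: barrage_0_iff split: if_splits\<close>)

lemma attack_requests:
  fixes P :: "'p set" and \<Q> :: "'p set set"
  shows "attack D l l' P s \<Longrightarrow> \<forall>r\<in>set s. fst r \<in> P \<and> snd r \<le> max l l'"
    and barrage_requests: "barrage D l l' \<Q> m t \<Longrightarrow> \<forall>r\<in>set t. fst r \<in> \<Union>\<Q> \<and> snd r \<le> max l l'"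
proof (induction rule: attack_barrage.inducts)
  case (attack_Suc l P \<Q> l' s)
  then show ?case using coveringD(3)[OF attack_Suc.hyps(1)] by fastforce
next
  case (barrage_Suc l l' \<Q> m t Q s)
  then show ?case by (auto split: if_splits)
qed auto

text \<open>
  The configuration \<open>f\<^sub>0\<close> carries the target labels of the levels above \<open>l\<close>, to which the labels of
  the levels up to \<open>l'\<close> may be changed in the first round.
\<close>

lemma attack_serves:
  fixes P :: "'p set" and \<Q> :: "'p set set"
  assumes "D > 0"
  shows "attack D l l' P s \<Longrightarrow> i \<in> {l<..k} \<Longrightarrow> f\<^sub>0 i \<in> P \<Longrightarrow> l \<le> l' \<Longrightarrow> (\<And>j. j > l' \<Longrightarrow> f j = f\<^sub>0 j) \<Longrightarrow>
      \<exists>f'. serves k f s f' \<and> (\<forall>j>l. f' j = f\<^sub>0 j)"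
    and barrage_serves: "barrage D l l' \<Q> m t \<Longrightarrow> (\<And>Q. Q \<in> \<Q> \<Longrightarrow> \<exists>i\<in>{l<..k}. f\<^sub>0 i \<in> Q) \<Longrightarrow> l \<le> l' \<Longrightarrow>
      (\<And>j. j > l' \<Longrightarrow> f j = f\<^sub>0 j) \<Longrightarrow>
      \<exists>f'. serves k f t f' \<and> (\<forall>j>(if m = 0 then l' else l). f' j = f\<^sub>0 j)"
proof (induction arbitrary: i f f\<^sub>0 and f f\<^sub>0 rule: attack_barrage.inducts)
  case (attack_0 l' x)
  then show ?case by (intro exI[of _ f\<^sub>0]) (auto simp: image_iff)
next
  case (attack_Suc l P \<Q> l' s)
  obtain q where q: "\<And>Q. Q \<in> \<Q> \<Longrightarrow> f\<^sub>0 i \<in> Q \<or> q \<in> Q"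
    using coveringD(6)[OF attack_Suc.hyps(1) \<open>f\<^sub>0 i \<in> P\<close>] by blast
  have "\<exists>i'\<in>{l<..k}. (f\<^sub>0(Suc l := q)) i' \<in> Q" if "Q \<in> \<Q>" for Q
    using q[OF that] \<open>i \<in> {Suc l<..k}\<close> by (auto intro: bexI[of _ i] bexI[of _ "Suc l"])
  moreover have "f j = (f\<^sub>0(Suc l := q)) j" if "l' < j" for j
    using attack_Suc.prems that by simp
  ultimately obtain f' where "serves k f s f'"
    "\<forall>j>(if 2 * (target_size l + 1) * D = 0 then l' else l). f' j = (f\<^sub>0(Suc l := q)) j"
    using attack_Suc.IH(2)[of "f\<^sub>0(Suc l := q)" f] \<open>Suc l \<le> l'\<close> by auto
  then show ?case using \<open>D > 0\<close> by (intro exI[of _ f']) auto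
next
  case (barrage_Suc l l' \<Q> m t Q s)
  let ?l = "if m = 0 then l' else l"
  obtain f' where f': "serves k f t f'" "\<And>j. j > ?l \<Longrightarrow> f' j = f\<^sub>0 j"
    using barrage_Suc.IH(2)[OF barrage_Suc.prems] by blast
  obtain i where i: "i \<in> {l<..k}" "f\<^sub>0 i \<in> Q"
    using barrage_Suc.prems(1) \<open>Q \<in> \<Q>\<close> by blast
  have "l \<le> ?l" using \<open>l \<le> l'\<close> by simp
  from barrage_Suc.IH(4)[where f = f' and f\<^sub>0 = f\<^sub>0, OF i this f'(2)] show ?case
    using f'(1) by (auto simp: serves_append)
qed auto

primrec overhead :: "nat \<Rightarrow> real" where
  "overhead 0 = 0"
| "overhead (Suc l) = 2 * (real (target_size l) + 1) * (2 + overhead l)"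

lemma sum_powers_le_double:
  fixes x :: real
  assumes "x \<ge> 2"
  shows "(\<Sum>i = 1..n. x ^ i) \<le> 2 * x ^ n"
proof (induction n)
  case (Suc n)
  have "2 * x ^ n \<le> x * x ^ n" using assms by (intro mult_right_mono) auto
  with Suc show ?case by simp
qed simp

lemma attack_reveal_cost:
  fixes P :: "'p set" and \<Q> :: "'p set set"
  assumes "D \<ge> 2"
  shows "attack D l l' P s \<Longrightarrow>
      reveal_cost (\<lambda>i. real D ^ i) s \<le> (\<Sum>i = 1..l'. real D ^ i) + overhead l * real D ^ l"
    and barrage_reveal_cost: "barrage D l l' \<Q> m t \<Longrightarrow>
      reveal_cost (\<lambda>i. real D ^ i) t \<le>
        (if m = 0 then 0 else \<Sum>i = 1..l'. real D ^ i) + real m * ((2 + overhead l) * real D ^ l)"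
proof (induction rule: attack_barrage.inducts)
  case (attack_Suc l P \<Q> l' s)
  then show ?case using \<open>D \<ge> 2\<close> by (simp add: algebra_simps)
next
  case (barrage_Suc l l' \<Q> m t Q s)
  show ?case
  proof (cases "m = 0")
    case True
    then have "reveal_cost (\<lambda>i. real D ^ i) (t @ s) \<le>
        (\<Sum>i = 1..l'. real D ^ i) + overhead l * real D ^ l"
      using barrage_Suc.IH by simp
    also have "\<dots> \<le> (\<Sum>i = 1..l'. real D ^ i) + (2 + overhead l) * real D ^ l"
      by (simp add: mult_right_mono)
    finally show ?thesis using True by simp
  next
    case False
    have "(\<Sum>i = 1..l. real D ^ i) \<le> 2 * real D ^ l"
      using \<open>D \<ge> 2\<close> by (intro sum_powers_le_double) simp
    then show ?thesis using barrage_Suc.IH False by (simp add: algebra_simps)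
  qed
qed auto

lemma barrage_accumulates:
  fixes \<phi> :: "'p input \<Rightarrow> real"
  assumes "0 \<le> \<phi> []" "0 \<le> y"
    and step: "\<And>r t. r < m \<Longrightarrow> barrage D l l' \<Q> r t \<Longrightarrow>
      \<exists>Q\<in>\<Q>. \<exists>s. attack D l (if r = 0 then l' else l) Q s \<and> min z (\<phi> t + y) \<le> \<phi> (t @ s)"
  shows "\<exists>t. barrage D l l' \<Q> m t \<and> min z (real m * y) \<le> \<phi> t"
  using step
proof (induction m)
  case 0
  show ?case using assms(1) by (intro exI[of _ "[]"]) (simp add: barrage_0)
next
  case (Suc m)
  then obtain t where t: "barrage D l l' \<Q> m t" "min z (real m * y) \<le> \<phi> t" by auto
  then obtain Q s where "Q \<in> \<Q>" "attack D l (if m = 0 then l' else l) Q s"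
    "min z (\<phi> t + y) \<le> \<phi> (t @ s)" using Suc.prems by blast
  moreover have "min z (real (Suc m) * y) \<le> min z (\<phi> t + y)"
    using t(2) \<open>0 \<le> y\<close> by (simp add: algebra_simps min_def split: if_splits)
  ultimately show ?case using barrage_Suc[OF t(1)] by (meson order.trans)
qed

section \<open>Phases\<close>

text \<open>All attacked sets contain \<open>q\<close>, so the label \<open>q\<close> on level \<open>k\<close> serves the whole phase.\<close>

definition phase :: "nat \<Rightarrow> nat \<Rightarrow> 'p set \<Rightarrow> 'p \<Rightarrow> nat \<Rightarrow> 'p input \<Rightarrow> bool" where
  "phase D k U q j t \<longleftrightarrow>
     barrage D (k - 1) k {Q. Q \<subseteq> U \<and> card Q = target_size (k - 1) \<and> q \<in> Q} j t"

lemma phase_0: "phase D k U q 0 []"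
  by (simp add: phase_def barrage_0)

lemma phase_Suc:
  assumes "phase D k U q j t" "attack D (k - 1) (if j = 0 then k else k - 1) Q s"
    and "Q \<subseteq> U" "card Q = target_size (k - 1)" "q \<in> Q"
  shows "phase D k U q (Suc j) (t @ s)"
  using assms unfolding phase_def by (intro barrage_Suc) auto

lemma servable_append_phase:
  assumes \<rho>: "servable k U \<rho>" and t: "phase D k U q j t" and "D > 0" "k \<ge> 1"
  shows "servable k U (\<rho> @ t)"
proof -
  from \<rho> obtain f f' where f': "serves k f \<rho> f'"
    by (auto simp: servable_def)
  have "\<exists>i\<in>{k - 1<..k}. (f'(k := q)) i \<in> Q" if "q \<in> Q" for Q
    using that \<open>k \<ge> 1\<close> by (intro bexI[of _ k]) auto
  then obtain f'' where "serves k f' t f''"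
    using barrage_serves[OF \<open>D > 0\<close> t[unfolded phase_def], of k "f'(k := q)" f'] by auto
  with f' have "\<exists>f f''. serves k f (\<rho> @ t) f''"
    by (auto simp: serves_append)
  moreover have "snd (hd (\<rho> @ t)) = k" if "\<rho> @ t \<noteq> []"
  proof (cases "\<rho> = []")
    case True
    then have "j > 0" using that t by (auto simp: phase_def barrage_0_iff intro: gr0I)
    then show ?thesis using barrage_hd[OF \<open>D > 0\<close> t[unfolded phase_def]] True by simp
  qed (use \<rho> in \<open>simp add: servable_def\<close>)
  moreover have "\<forall>r\<in>set (\<rho> @ t). fst r \<in> U \<and> snd r \<le> k"
    using \<rho> barrage_requests[OF t[unfolded phase_def]] by (fastforce simp: servable_def)
  ultimately show ?thesis
    by (simp add: servable_def)
qed

lemma phase_reveal_cost: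
  assumes t: "phase D k U q j t" and "D \<ge> 2" "k \<ge> 1" and "real j * (2 + overhead (k - 1)) \<le> real D"
  shows "reveal_cost (\<lambda>i. real D ^ i) t \<le> 3 * real D ^ k"
proof -
  have "reveal_cost (\<lambda>i. real D ^ i) t \<le>
      (if j = 0 then 0 else \<Sum>i = 1..k. real D ^ i) +
      real j * ((2 + overhead (k - 1)) * real D ^ (k - 1))"
    using barrage_reveal_cost[OF \<open>D \<ge> 2\<close> t[unfolded phase_def]] .
  moreover have "(if j = 0 then 0 else \<Sum>i = 1..k. real D ^ i) \<le> 2 * real D ^ k"
    using sum_powers_le_double[of "real D" k] \<open>D \<ge> 2\<close> by simp
  moreover have "real j * ((2 + overhead (k - 1)) * real D ^ (k - 1)) \<le> real D * real D ^ (k - 1)"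
    unfolding mult.assoc[symmetric] using assms(4) by (rule mult_right_mono) simp
  moreover have "real D * real D ^ (k - 1) = real D ^ k"
    using \<open>k \<ge> 1\<close> by (simp add: power_eq_if)
  ultimately show ?thesis by linarith
qed

lemma exists_subset_card_Int:
  assumes "finite U" "S \<subseteq> U" "c \<le> card S" "c \<le> n" "n - c \<le> card U - card S"
  shows "\<exists>Q\<subseteq>U. card Q = n \<and> card (S \<inter> Q) = c"
proof -
  have "finite S" using assms(1,2) finite_subset by blast
  obtain S' where S': "S' \<subseteq> S" "card S' = c" "finite S'"
    using obtain_subset_with_card_n[OF assms(3)] .
  have "n - c \<le> card (U - S)"
    using assms(2,5) \<open>finite S\<close> by (simp add: card_Diff_subset)
  then obtain E where E: "E \<subseteq> U - S" "card E = n - c" "finite E"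
    by (rule obtain_subset_with_card_n)
  have "card (S' \<union> E) = n"
    using S' E \<open>c \<le> n\<close> by (subst card_Un_disjoint) auto
  moreover have "S \<inter> (S' \<union> E) = S'" "S' \<union> E \<subseteq> U"
    using S'(1) E(1) assms(2) by auto
  ultimately show ?thesis using S'(2) by (intro exI[of _ "S' \<union> E"]) simp
qed

section \<open>The expected cost of an algorithm\<close>

lemma moves_snoc:
  "moves A (\<rho> @ [r]) i = moves A \<rho> i + of_bool (A (\<rho> @ [r]) i \<noteq> A \<rho> i)"
proof -
  let ?n = "length \<rho>"
  have "{t \<in> {1..length (\<rho> @ [r])}. A (take t (\<rho> @ [r])) i \<noteq> A (take (t - 1) (\<rho> @ [r])) i} =
      {t \<in> {1..?n}. A (take t \<rho>) i \<noteq> A (take (t - 1) \<rho>) i} \<union>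
      (if A (\<rho> @ [r]) i \<noteq> A \<rho> i then {Suc ?n} else {})"
    by (auto simp: le_Suc_eq)
  then show ?thesis
    unfolding moves_def by (simp add: card_insert_if)
qed

lemma moves_append_ge:
  "moves A \<rho> i + of_bool (A (\<rho> @ s) i \<noteq> A \<rho> i) \<le> moves A (\<rho> @ s) i"
proof (induction s rule: rev_induct)
  case (snoc r s)
  then show ?case using moves_snoc[of A "\<rho> @ s" r i] by (auto simp: of_bool_def split: if_splits)
qed simp

lemma algorithm_cost_snoc:
  "algorithm_cost k w A (\<rho> @ [r]) =
     algorithm_cost k w A \<rho> + (\<Sum>i = 1..k. w i * of_bool (A (\<rho> @ [r]) i \<noteq> A \<rho> i))"
  unfolding algorithm_cost_def
  by (simp add: moves_snoc sum.distrib distrib_left)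

lemma algorithm_cost_append_ge:
  assumes "\<And>i. i \<in> {1..k} \<Longrightarrow> 0 \<le> w i"
  shows "algorithm_cost k w A \<rho> + (\<Sum>i = 1..k. w i * of_bool (A (\<rho> @ s) i \<noteq> A \<rho> i)) \<le>
    algorithm_cost k w A (\<rho> @ s)"
  unfolding algorithm_cost_def sum.distrib[symmetric] distrib_left[symmetric]
proof (intro sum_mono mult_left_mono)
  fix i show "real (moves A \<rho> i) + of_bool (A (\<rho> @ s) i \<noteq> A \<rho> i) \<le> real (moves A (\<rho> @ s) i)"
    using moves_append_ge[of A \<rho> i s] by (metis of_nat_add of_nat_le_iff of_nat_of_bool)
qed (use assms in auto)

lemma (in finite_measure) exists_measure_ge_average:
  assumes "finite I" "I \<noteq> {}" and F: "\<And>i. i \<in> I \<Longrightarrow> F i \<in> sets M" and cov: "G \<subseteq> (\<Union>i\<in>I. F i)"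
  shows "\<exists>i\<in>I. measure M G / real (card I) \<le> measure M (F i)"
proof (rule ccontr)
  assume "\<not> ?thesis"
  then have less: "measure M (F i) < measure M G / real (card I)" if "i \<in> I" for i
    using that by (meson linorder_not_le)
  have "measure M G \<le> measure M (\<Union>i\<in>I. F i)"
    using F \<open>finite I\<close> cov by (intro finite_measure_mono) auto
  also have "\<dots> \<le> (\<Sum>i\<in>I. measure M (F i))"
    using F \<open>finite I\<close> by (intro finite_measure_subadditive_finite) auto
  also have "\<dots> < (\<Sum>i\<in>I. measure M G / real (card I))"
    using less assms(1,2) by (intro sum_strict_mono) auto
  also have "\<dots> = measure M G"
    using assms(1,2) by simp
  finally show False by simp
qed

locale randomized_server_algorithm =
  fixes k :: nat and w :: "nat \<Rightarrow> real"
    and U :: "'p :: countable set" and M :: "'p algorithm measure"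
  assumes randomized: "randomized_algorithm k U M"
    and weight_nonneg: "\<And>i. i \<in> {1..k} \<Longrightarrow> 0 \<le> w i" and weight_mono: "mono_on {1..k} w"
begin

sublocale prob_space M
  using randomized by (simp add: randomized_algorithm_def)

abbreviation cost :: "'p algorithm \<Rightarrow> 'p input \<Rightarrow> real" where
  "cost \<equiv> algorithm_cost k w"

lemma cost_append_ge_cost: "cost A \<rho> \<le> cost A (\<rho> @ s)"
  using algorithm_cost_append_ge[of k w A \<rho> s, OF weight_nonneg]
    sum_nonneg[of "{1..k}" "\<lambda>i. w i * of_bool (A (\<rho> @ s) i \<noteq> A \<rho> i)"] weight_nonneg
  by force

lemma cost_append_ge_weight:
  assumes "i \<in> {1..k}" "A (\<rho> @ s) i \<noteq> A \<rho> i"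
  shows "cost A \<rho> + w i \<le> cost A (\<rho> @ s)"
proof -
  have "w i = w i * of_bool (A (\<rho> @ s) i \<noteq> A \<rho> i)"
    using assms(2) by simp
  also have "\<dots> \<le> (\<Sum>i = 1..k. w i * of_bool (A (\<rho> @ s) i \<noteq> A \<rho> i))"
    using assms(1) weight_nonneg by (intro member_le_sum) auto
  finally show ?thesis
    using algorithm_cost_append_ge[of k w A \<rho> s, OF weight_nonneg] by linarith
qed

lemma measurable_position:
  assumes "valid_input k U \<rho>" "i \<in> {1..k}"
  shows "(\<lambda>A. A \<rho> i) \<in> measurable M (count_space UNIV)"
  using randomized assms unfolding randomized_algorithm_def by blast

lemma sets_position:
  assumes "valid_input k U \<rho>" "i \<in> {1..k}" "G \<in> sets M"
  shows "{A \<in> G. A \<rho> i \<in> X} \<in> sets M"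
proof -
  have "{A \<in> G. A \<rho> i \<in> X} = G \<inter> ((\<lambda>A. A \<rho> i) -` X \<inter> space M)"
    using sets.sets_into_space[OF assms(3)] by auto
  then show ?thesis
    using measurable_sets[OF measurable_position[OF assms(1,2)]] assms(3) by simp
qed

lemma integrable_move:
  assumes "valid_input k U \<rho>" "valid_input k U \<rho>'" "i \<in> {1..k}"
  shows "integrable M (\<lambda>A. of_bool (A \<rho> i \<noteq> A \<rho>' i) :: real)"
proof (rule integrable_const_bound)
  show "(\<lambda>A. of_bool (A \<rho> i \<noteq> A \<rho>' i) :: real) \<in> borel_measurable M"
    using measurable_position[OF assms(1,3)] measurable_position[OF assms(2,3)] by measurable
  show "AE A in M. norm (of_bool (A \<rho> i \<noteq> A \<rho>' i) :: real) \<le> 1"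
    by simp
qed

lemma integrable_cost:
  "valid_input k U \<rho> \<Longrightarrow> integrable M (\<lambda>A. cost A \<rho>)"
proof (induction \<rho> rule: rev_induct)
  case Nil
  show ?case by (simp add: algorithm_cost_def moves_def)
next
  case (snoc r \<rho>)
  note valid = valid_input_appendD[OF snoc.prems]
  show ?case
    unfolding algorithm_cost_snoc
    by (intro Bochner_Integration.integrable_add Bochner_Integration.integrable_sum snoc.IH[OF valid]
        integrable_mult_right integrable_move[OF snoc.prems valid])
qed

lemma competitive_ratio_ge:
  assumes comp: "competitive k w U \<alpha> M" and "0 \<le> a" "0 < b"
    and inputs: "\<And>n. \<exists>\<rho>. valid_input k U \<rho> \<and> pattern_cost k w (final_pattern \<rho>) \<le> real n * a \<and>
      real n * b \<le> expectation (\<lambda>A. cost A \<rho>)"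
  shows "b \<le> \<alpha> * a"
proof (rule ccontr)
  assume "\<not> b \<le> \<alpha> * a"
  then have pos: "0 < b - max \<alpha> 0 * a"
    using \<open>0 < b\<close> by (simp add: max_def)
  from comp obtain c where upper: "\<And>\<rho>. valid_input k U \<rho> \<Longrightarrow>
      expectation (\<lambda>A. cost A \<rho>) \<le> \<alpha> * pattern_cost k w (final_pattern \<rho>) + c"
    unfolding competitive_def by blast
  have "real n * (b - max \<alpha> 0 * a) \<le> c" for n
  proof -
    obtain \<rho> where \<rho>: "valid_input k U \<rho>" "pattern_cost k w (final_pattern \<rho>) \<le> real n * a"
      "real n * b \<le> expectation (\<lambda>A. cost A \<rho>)" using inputs by blast
    have "0 \<le> pattern_cost k w (final_pattern \<rho>)"
      unfolding pattern_cost_def by (intro sum_nonneg mult_nonneg_nonneg weight_nonneg) simp_all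
    then have "\<alpha> * pattern_cost k w (final_pattern \<rho>) \<le> max \<alpha> 0 * (real n * a)"
      using \<rho>(2) by (intro mult_mono) auto
    with \<rho>(3) upper[OF \<rho>(1)] show ?thesis by (simp add: algebra_simps)
  qed
  moreover obtain n where "c < real n * (b - max \<alpha> 0 * a)"
    using reals_Archimedean3[OF pos] by blast
  ultimately show False by (meson linorder_not_le)
qed

definition extra_cost :: "'p algorithm set \<Rightarrow> 'p input \<Rightarrow> 'p input \<Rightarrow> real" where
  "extra_cost G \<rho> s = (LINT A:G|M. cost A (\<rho> @ s) - cost A \<rho>)"

lemma set_integrable_extra_cost:
  assumes "valid_input k U (\<rho> @ s)" "G \<in> sets M"
  shows "set_integrable M G (\<lambda>A. cost A (\<rho> @ s) - cost A \<rho>)"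
  unfolding set_integrable_def using assms integrable_cost valid_input_appendD
  by (intro integrable_mult_indicator Bochner_Integration.integrable_diff) blast+

lemma extra_cost_Nil [simp]: "extra_cost G \<rho> [] = 0"
  by (simp add: extra_cost_def)

lemma extra_cost_empty [simp]: "extra_cost {} \<rho> s = 0"
  by (simp add: extra_cost_def set_lebesgue_integral_def)

lemma extra_cost_append:
  assumes "valid_input k U (\<rho> @ s @ t)" "G \<in> sets M"
  shows "extra_cost G \<rho> (s @ t) = extra_cost G \<rho> s + extra_cost G (\<rho> @ s) t"
proof -
  have valid: "valid_input k U ((\<rho> @ s) @ t)" using assms by simp
  show ?thesis
    unfolding extra_cost_def
    using set_integral_add(2)[OF set_integrable_extra_cost[OF valid_input_appendD[OF valid] assms(2)]
        set_integrable_extra_cost[OF valid assms(2)]]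
    by simp
qed

lemma extra_cost_space:
  assumes "valid_input k U (\<rho> @ s)"
  shows "extra_cost (space M) \<rho> s = expectation (\<lambda>A. cost A (\<rho> @ s)) - expectation (\<lambda>A. cost A \<rho>)"
  unfolding extra_cost_def
  using integrable_cost[OF assms] integrable_cost[OF valid_input_appendD[OF assms]]
  by (subst set_integral_space) simp_all

lemma extra_cost_mono:
  assumes "valid_input k U (\<rho> @ s)" "G \<in> sets M" "H \<in> sets M" "H \<subseteq> G"
  shows "extra_cost H \<rho> s \<le> extra_cost G \<rho> s"
  unfolding extra_cost_def set_lebesgue_integral_def
proof (rule integral_mono)
  fix A
  show "indicator H A *\<^sub>R (cost A (\<rho> @ s) - cost A \<rho>) \<le>
      indicator G A *\<^sub>R (cost A (\<rho> @ s) - cost A \<rho>)"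
    using \<open>H \<subseteq> G\<close> cost_append_ge_cost[of A \<rho> s] by (auto simp: indicator_def)
qed (use assms set_integrable_extra_cost in \<open>simp_all add: set_integrable_def\<close>)

lemma extra_cost_append_ge:
  assumes "valid_input k U (\<rho> @ s @ t)" "G \<in> sets M" "H \<in> sets M" "H \<subseteq> G"
  shows "extra_cost G \<rho> s + extra_cost H (\<rho> @ s) t \<le> extra_cost G \<rho> (s @ t)"
  using extra_cost_append[OF assms(1,2)] extra_cost_mono[of "\<rho> @ s" t G H] assms by simp

lemma prob_mult_weight_le_extra_cost:
  assumes valid: "valid_input k U (\<rho> @ s)" and G: "G \<in> sets M" and H: "H \<in> sets M" "H \<subseteq> G"
    and moves: "\<And>A. A \<in> H \<Longrightarrow> \<exists>i\<in>{l..k}. A (\<rho> @ s) i \<noteq> A \<rho> i" and "l \<in> {1..k}"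
  shows "prob H * w l \<le> extra_cost G \<rho> s"
proof -
  have "prob H * w l = (LINT A:H|M. w l)"
    using H(1) by (simp add: set_integral_const emeasure_eq_measure)
  also have "\<dots> \<le> extra_cost H \<rho> s"
    unfolding extra_cost_def
  proof (rule set_integral_mono[OF _ set_integrable_extra_cost[OF valid H(1)]])
    show "set_integrable M H (\<lambda>A. w l)"
      unfolding set_integrable_def using H(1) by (intro integrable_mult_indicator) auto
    fix A assume "A \<in> H"
    then obtain i where i: "i \<in> {l..k}" "A (\<rho> @ s) i \<noteq> A \<rho> i"
      using moves by blast
    then have "w l \<le> w i"
      using \<open>l \<in> {1..k}\<close> by (intro mono_onD[OF weight_mono]) auto
    also have "w i \<le> cost A (\<rho> @ s) - cost A \<rho>"
      using cost_append_ge_weight[of i A \<rho> s] i \<open>l \<in> {1..k}\<close> by simp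
    finally show "w l \<le> cost A (\<rho> @ s) - cost A \<rho>" .
  qed
  also have "\<dots> \<le> extra_cost G \<rho> s"
    by (rule extra_cost_mono[OF valid G H])
  finally show ?thesis .
qed

definition avoids_above :: "nat \<Rightarrow> 'p set \<Rightarrow> 'p input \<Rightarrow> 'p algorithm \<Rightarrow> bool" where
  "avoids_above l P \<rho> A \<longleftrightarrow> (\<forall>i\<in>{l<..k}. A \<rho> i \<notin> P)"

lemma request_extra_cost:
  assumes valid: "valid_input k U (\<rho> @ [(x, l)])" and G: "G \<in> sets M" and "k \<ge> 1"
    and away: "\<And>A. A \<in> G \<Longrightarrow> avoids_above 0 {x} \<rho> A"
  shows "prob G * w 1 \<le> extra_cost G \<rho> [(x, l)]"
proof (rule prob_mult_weight_le_extra_cost[OF valid G G order.refl])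
  fix A assume "A \<in> G"
  then have "online_algorithm k U A"
    using randomized sets.sets_into_space[OF G] unfolding randomized_algorithm_def by blast
  then obtain i where "i \<in> {1..k}" "A (\<rho> @ [(x, l)]) i = x"
    using valid unfolding online_algorithm_def by fastforce
  moreover have "A \<rho> i \<noteq> x"
    using away[OF \<open>A \<in> G\<close>] \<open>i \<in> {1..k}\<close> by (auto simp: avoids_above_def)
  ultimately show "\<exists>i\<in>{1..k}. A (\<rho> @ [(x, l)]) i \<noteq> A \<rho> i" by metis
qed (use \<open>k \<ge> 1\<close> in simp)

lemma half_avoids_above:
  assumes valid: "valid_input k U (\<rho> @ t)" and G: "G \<in> sets M" and "l < k"
    and away: "\<And>A. A \<in> G \<Longrightarrow> avoids_above l P \<rho> A"
    and cheap: "extra_cost G \<rho> t < prob G * w (Suc l) / 2"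
  shows "\<exists>G'\<in>sets M. G' \<subseteq> G \<and> prob G / 2 \<le> prob G' \<and> (\<forall>A\<in>G'. avoids_above l P (\<rho> @ t) A)"
proof -
  define H where "H = (\<Union>i\<in>{l<..k}. {A \<in> G. A (\<rho> @ t) i \<in> P})"
  have H: "H \<in> sets M" "H \<subseteq> G"
    unfolding H_def using G valid by (auto intro!: sets.finite_UN sets_position)
  have "\<exists>i\<in>{Suc l..k}. A (\<rho> @ t) i \<noteq> A \<rho> i" if "A \<in> H" for A
    using that away[of A]
    unfolding H_def avoids_above_def atLeastSucAtMost_greaterThanAtMost by force
  then have "prob H * w (Suc l) \<le> extra_cost G \<rho> t"
    using \<open>l < k\<close> by (intro prob_mult_weight_le_extra_cost[OF valid G H]) auto
  with cheap have "prob H * w (Suc l) < prob G / 2 * w (Suc l)" by simp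
  then have "prob H < prob G / 2"
    by (rule mult_right_less_imp_less) (use weight_nonneg \<open>l < k\<close> in auto)
  then have "prob G / 2 \<le> prob (G - H)"
    using finite_measure_Diff[OF G H] by simp
  moreover have "\<forall>A\<in>G - H. avoids_above l P (\<rho> @ t) A"
    by (auto simp: H_def avoids_above_def)
  ultimately show ?thesis
    using G H(1) by (intro bexI[of _ "G - H"]) auto
qed

lemma exists_likely_missed_set:
  assumes "finite \<Q>" "\<And>x. \<exists>Q\<in>\<Q>. x \<notin> Q" "valid_input k U \<rho>" "i \<in> {1..k}" "G \<in> sets M"
  shows "\<exists>Q\<in>\<Q>. prob G / real (card \<Q>) \<le> prob {A \<in> G. A \<rho> i \<notin> Q}"
proof (rule exists_measure_ge_average)
  show "{A \<in> G. A \<rho> i \<notin> Q} \<in> sets M" for Q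
    using sets_position[OF assms(3-5), of "- Q"] by simp
qed (use assms in auto)

lemma exists_avoided_member:
  assumes cov: "covering n P \<Q>" and valid: "valid_input k U (\<rho> @ t)" and G: "G \<in> sets M"
    and "Suc l < k"
    and away: "\<And>A. A \<in> G \<Longrightarrow> avoids_above (Suc l) P \<rho> A"
    and cheap: "extra_cost G \<rho> t < prob G * w (l + 2) / 2"
  shows "\<exists>Q\<in>\<Q>. \<exists>F\<in>sets M. F \<subseteq> G \<and> prob G / (2 * (real n + 1)) \<le> prob F \<and>
    (\<forall>A\<in>F. avoids_above l Q (\<rho> @ t) A)"
proof -
  obtain G' where G': "G' \<in> sets M" "G' \<subseteq> G" "prob G / 2 \<le> prob G'"
    "\<forall>A\<in>G'. avoids_above (Suc l) P (\<rho> @ t) A"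
    using half_avoids_above[OF valid G \<open>Suc l < k\<close> away] cheap by auto
  obtain Q where Q: "Q \<in> \<Q>" "prob G' / real (card \<Q>) \<le> prob {A \<in> G'. A (\<rho> @ t) (Suc l) \<notin> Q}"
    using exists_likely_missed_set[OF coveringD(1,5)[OF cov] valid _ G'(1), of "Suc l"] \<open>Suc l < k\<close>
    by auto
  let ?F = "{A \<in> G'. A (\<rho> @ t) (Suc l) \<notin> Q}"
  have "card \<Q> > 0"
    using Q(1) coveringD(1)[OF cov] card_gt_0_iff by blast
  then have "prob G / 2 / (real n + 1) \<le> prob G' / real (card \<Q>)"
    using G'(3) coveringD(2)[OF cov] by (intro frac_le) auto
  with Q(2) have "prob G / (2 * (real n + 1)) \<le> prob ?F" by simp
  moreover have "avoids_above l Q (\<rho> @ t) A" if A: "A \<in> ?F" for A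
    unfolding avoids_above_def
  proof
    fix i assume i: "i \<in> {l<..k}"
    have "A (\<rho> @ t) i \<notin> P" if "i \<noteq> Suc l"
      using A G'(4) i that by (auto simp: avoids_above_def)
    then show "A (\<rho> @ t) i \<notin> Q"
      using A coveringD(3)[OF cov Q(1)] by blast
  qed
  moreover have "?F \<in> sets M"
    using sets_position[OF valid _ G'(1), of "Suc l" "- Q"] \<open>Suc l < k\<close> by simp
  ultimately show ?thesis
    using Q(1) G'(2) by (intro bexI[of _ Q] bexI[of _ ?F]) auto
qed

lemma exists_halving_set:
  assumes "valid_input k U \<rho>" "k \<ge> 1" "finite U" "card U = 2 * n" "S \<subseteq> U" "card S = 2 * c" "c \<le> n"
  shows "\<exists>Q\<subseteq>U. card Q = n \<and> card (S \<inter> Q) = c \<and> 1 / 2 \<le> prob {A \<in> space M. A \<rho> k \<notin> Q}"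
proof -
  have "c \<le> card S" "n - c \<le> card U - card S"
    using assms(4,6) by simp_all
  then obtain Q where Q: "Q \<subseteq> U" "card Q = n" "card (S \<inter> Q) = c"
    using exists_subset_card_Int[OF assms(3,5) _ assms(7)] by metis
  have "finite Q" "finite (S \<inter> Q)"
    using Q(1) assms(3) by (auto intro: finite_subset)
  moreover have "S \<inter> (U - Q) = S - S \<inter> Q"
    using \<open>S \<subseteq> U\<close> by auto
  ultimately have compl: "card (U - Q) = n" "card (S \<inter> (U - Q)) = c"
    using Q assms(4,6) by (simp_all add: card_Diff_subset)
  have "\<exists>Q'\<in>{Q, U - Q}. prob (space M) / real (card {Q, U - Q}) \<le> prob {A \<in> space M. A \<rho> k \<notin> Q'}"
    by (rule exists_likely_missed_set) (use assms(1,2) in auto)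
  then obtain Q' where Q': "Q' \<in> {Q, U - Q}"
    "prob (space M) / real (card {Q, U - Q}) \<le> prob {A \<in> space M. A \<rho> k \<notin> Q'}"
    by (rule bexE)
  have "1 / 2 \<le> 1 / real (card {Q, U - Q})"
    by (intro divide_left_mono) (simp_all add: card_insert_if)
  with Q'(2) have "1 / 2 \<le> prob {A \<in> space M. A \<rho> k \<notin> Q'}"
    by (simp add: prob_space)
  moreover have "Q' \<subseteq> U" "card Q' = n" "card (S \<inter> Q') = c"
    using Q'(1) Q compl by auto
  ultimately show ?thesis by blast
qed

end

section \<open>The cost of an attack\<close>

locale geometric_server_algorithm = randomized_server_algorithm k "\<lambda>i. real D ^ i" U M
  for k D :: nat and U :: "'p :: countable set" and M :: "'p algorithm measure" +
  assumes k_ge_1: "k \<ge> 1" and D_ge_2: "D \<ge> 2"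
begin

abbreviation w :: "nat \<Rightarrow> real" where
  "w i \<equiv> real D ^ i"

definition attacks_costly :: "nat \<Rightarrow> bool" where
  "attacks_costly l \<longleftrightarrow> (\<forall>l' P \<rho>. \<forall>G\<in>sets M.
     card P = target_size l \<longrightarrow> (\<forall>s. attack D l l' P s \<longrightarrow> valid_input k U (\<rho> @ s)) \<longrightarrow>
     (\<forall>A\<in>G. avoids_above l P \<rho> A) \<longrightarrow>
     (\<exists>s. attack D l l' P s \<and> prob G * w (l + 1) / 2 \<le> extra_cost G \<rho> s))"

lemma attacks_costlyE:
  assumes "attacks_costly l" "card P = target_size l"
    and "\<And>s. attack D l l' P s \<Longrightarrow> valid_input k U (\<rho> @ s)"
    and "G \<in> sets M" "\<And>A. A \<in> G \<Longrightarrow> avoids_above l P \<rho> A"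
  obtains s where "attack D l l' P s" "prob G * w (l + 1) / 2 \<le> extra_cost G \<rho> s"
  using assms unfolding attacks_costly_def by blast

lemma attacks_costly_0: "attacks_costly 0"
  unfolding attacks_costly_def
proof (intro allI ballI impI)
  fix l' and P :: "'p set" and \<rho> G
  assume valid: "\<forall>s. attack D 0 l' P s \<longrightarrow> valid_input k U (\<rho> @ s)" and G: "G \<in> sets M"
    and away: "\<forall>A\<in>G. avoids_above 0 P \<rho> A" and "card P = target_size 0"
  then obtain x where P: "P = {x}" by (auto simp: card_1_singleton_iff)
  then have "valid_input k U (\<rho> @ [(x, l')])" using valid by (simp add: attack_0)
  then have "prob G * w 1 \<le> extra_cost G \<rho> [(x, l')]"
    using G away P k_ge_1 by (intro request_extra_cost) auto
  moreover have "prob G * w 1 / 2 \<le> prob G * w 1" by simp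
  ultimately have "prob G * w 1 / 2 \<le> extra_cost G \<rho> [(x, l')]" by linarith
  then show "\<exists>s. attack D 0 l' P s \<and> prob G * w (0 + 1) / 2 \<le> extra_cost G \<rho> s"
    using P by (intro exI[of _ "[(x, l')]"]) (simp add: attack_0)
qed

text \<open>
  Either the servers above \<open>Suc l\<close> have entered \<open>P\<close> on half of \<open>G\<close>, which has cost enough, or the
  next attack hits server \<open>Suc l\<close> on a fraction of the other half.
\<close>

lemma costly_attack_on_member_exists:
  assumes costly: "attacks_costly l" and "Suc l < k" and cov: "covering (target_size l) P \<Q>"
    and valid: "valid_input k U (\<rho> @ t)"
      "\<And>Q s. Q \<in> \<Q> \<Longrightarrow> attack D l l' Q s \<Longrightarrow> valid_input k U (\<rho> @ t @ s)"
    and G: "G \<in> sets M" "\<And>A. A \<in> G \<Longrightarrow> avoids_above (Suc l) P \<rho> A"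
    and hit_cost: "hit_cost = prob G / (2 * (real (target_size l) + 1)) * w (l + 1) / 2"
  shows "\<exists>Q\<in>\<Q>. \<exists>s. attack D l l' Q s \<and>
    min (prob G * w (l + 2) / 2) (extra_cost G \<rho> t + hit_cost) \<le> extra_cost G \<rho> (t @ s)"
proof (cases "extra_cost G \<rho> t < prob G * w (l + 2) / 2")
  case True
  obtain Q F where Q: "Q \<in> \<Q>" and F: "F \<in> sets M" "F \<subseteq> G"
    and likely: "prob G / (2 * (real (target_size l) + 1)) \<le> prob F"
    and away: "\<And>A. A \<in> F \<Longrightarrow> avoids_above l Q (\<rho> @ t) A"
    using exists_avoided_member[OF cov valid(1) G(1) \<open>Suc l < k\<close> G(2) True] by auto
  have "valid_input k U ((\<rho> @ t) @ s)" if "attack D l l' Q s" for s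
    using valid(2)[OF Q that] by simp
  from attacks_costlyE[OF costly coveringD(4)[OF cov Q] this F(1) away]
  obtain s where s: "attack D l l' Q s" "prob F * w (l + 1) / 2 \<le> extra_cost F (\<rho> @ t) s" .
  have "hit_cost \<le> prob F * w (l + 1) / 2"
    unfolding hit_cost using likely by (intro divide_right_mono mult_right_mono) auto
  then have "extra_cost G \<rho> t + hit_cost \<le> extra_cost G \<rho> (t @ s)"
    using s(2) extra_cost_append_ge[OF valid(2)[OF Q s(1)] G(1) F] by linarith
  then show ?thesis using Q s(1) by (intro bexI[of _ Q] exI[of _ s]) simp_all
next
  case False
  obtain Q s where Q: "Q \<in> \<Q>" "attack D l l' Q s"
    using covering_attack_exists[OF cov] by blast
  then have "extra_cost G \<rho> t \<le> extra_cost G \<rho> (t @ s)"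
    using extra_cost_append_ge[OF valid(2) G(1) sets.empty_sets] by simp
  then show ?thesis using False Q by (intro bexI[of _ Q] exI[of _ s]) simp_all
qed

lemma attacks_costly_Suc:
  assumes costly: "attacks_costly l" and "Suc l < k"
  shows "attacks_costly (Suc l)"
  unfolding attacks_costly_def
proof (intro allI ballI impI)
  fix l' and P :: "'p set" and \<rho> G
  assume valid: "\<forall>s. attack D (Suc l) l' P s \<longrightarrow> valid_input k U (\<rho> @ s)" and G: "G \<in> sets M"
    and away: "\<forall>A\<in>G. avoids_above (Suc l) P \<rho> A" and P: "card P = target_size (Suc l)"
  define m where "m = 2 * (target_size l + 1) * D"
  define hit_cost where "hit_cost = prob G / (2 * (real (target_size l) + 1)) * w (l + 1) / 2"
  obtain \<Q> where cov: "covering (target_size l) P \<Q>"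
    using covering_target_exists[OF P] ..
  have valid_prefix: "valid_input k U (\<rho> @ t)" if "barrage D l l' \<Q> r t" "r \<le> m" for r t
    using valid_input_append_barrage[OF cov _ that(1)] that(2) valid by (simp add: m_def)
  have "\<exists>Q\<in>\<Q>. \<exists>s. attack D l (if r = 0 then l' else l) Q s \<and>
      min (prob G * w (l + 2) / 2) (extra_cost G \<rho> t + hit_cost) \<le> extra_cost G \<rho> (t @ s)"
    if "r < m" and t: "barrage D l l' \<Q> r t" for r t
  proof (rule costly_attack_on_member_exists[OF costly \<open>Suc l < k\<close> cov _ _ G _ hit_cost_def])
    show "valid_input k U (\<rho> @ t)" "\<And>A. A \<in> G \<Longrightarrow> avoids_above (Suc l) P \<rho> A"
      using valid_prefix[OF t] \<open>r < m\<close> away by simp_all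
    fix Q s assume "Q \<in> \<Q>" "attack D l (if r = 0 then l' else l) Q s"
    from barrage_Suc[OF t this] show "valid_input k U (\<rho> @ t @ s)"
      using valid_prefix \<open>r < m\<close> by simp
  qed
  moreover have "0 \<le> hit_cost"
    by (simp add: hit_cost_def)
  ultimately obtain t where t: "barrage D l l' \<Q> m t"
    "min (prob G * w (l + 2) / 2) (real m * hit_cost) \<le> extra_cost G \<rho> t"
    using barrage_accumulates[of "extra_cost G \<rho>" hit_cost m D l l' \<Q> "prob G * w (l + 2) / 2"]
    by auto
  have "real m * hit_cost = prob G * w (l + 2) / 2"
    by (simp add: m_def hit_cost_def field_simps)
  then show "\<exists>s. attack D (Suc l) l' P s \<and> prob G * w (Suc l + 1) / 2 \<le> extra_cost G \<rho> s"
    using t attack_Suc[OF cov] by (auto simp: m_def)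
qed

lemma attacks_costly: "l < k \<Longrightarrow> attacks_costly l"
  by (induction l) (simp_all add: attacks_costly_0 attacks_costly_Suc)

section \<open>The cost of a phase\<close>

lemma valid_input_append_phase:
  assumes "servable k U \<rho>" "phase D k U q j t"
  shows "valid_input k U (\<rho> @ t)"
  using servable_append_phase[OF assms] D_ge_2 k_ge_1 by (intro servable_imp_valid_input) simp

lemma phase_extend:
  assumes U: "finite U" "card U = 2 * target_size (k - 1)" and \<rho>: "servable k U \<rho>"
    and S: "S \<subseteq> U" "card S = 2 * c" and c: "0 < c" "c \<le> target_size (k - 1)"
    and t: "\<And>q. q \<in> S \<Longrightarrow> phase D k U q j t"
  shows "\<exists>s. \<exists>S'\<subseteq>S. card S' = c \<and> (\<forall>q\<in>S'. phase D k U q (Suc j) (t @ s)) \<and>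
    extra_cost (space M) \<rho> t + w k / 4 \<le> extra_cost (space M) \<rho> (t @ s)"
proof -
  let ?l = "if j = 0 then k else k - 1"
  have "S \<noteq> {}" using S(2) c(1) by auto
  then have valid: "valid_input k U (\<rho> @ t)"
    using valid_input_append_phase[OF \<rho> t] by blast
  obtain Q where Q: "Q \<subseteq> U" "card Q = target_size (k - 1)" "card (S \<inter> Q) = c"
    and half: "1 / 2 \<le> prob {A \<in> space M. A (\<rho> @ t) k \<notin> Q}"
    using exists_halving_set[OF valid k_ge_1 U S c(2)] by auto
  let ?G = "{A \<in> space M. A (\<rho> @ t) k \<notin> Q}"
  have G: "?G \<in> sets M"
    using sets_position[OF valid _ sets.top, of k "- Q"] k_ge_1 by simp
  have phase: "phase D k U q (Suc j) (t @ s)" if "q \<in> S \<inter> Q" "attack D (k - 1) ?l Q s" for q s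
    using phase_Suc[OF t that(2) Q(1,2)] that(1) by simp
  obtain q where "q \<in> S \<inter> Q" using Q(3) c(1) by (metis card_gt_0_iff ex_in_conv)
  then have valid_next: "valid_input k U (\<rho> @ t @ s)" if "attack D (k - 1) ?l Q s" for s
    using valid_input_append_phase[OF \<rho> phase] that by blast
  have "{k - 1<..k} = {k}" using k_ge_1 by auto
  then have "avoids_above (k - 1) Q (\<rho> @ t) A" if "A \<in> ?G" for A
    using that by (simp add: avoids_above_def)
  then obtain s where s: "attack D (k - 1) ?l Q s"
    "prob ?G * w (k - 1 + 1) / 2 \<le> extra_cost ?G (\<rho> @ t) s"
    using attacks_costlyE[OF attacks_costly Q(2) _ G, of ?l "\<rho> @ t"] valid_next k_ge_1 by auto
  have "w k / 4 \<le> prob ?G * w (k - 1 + 1) / 2"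
    using mult_right_mono[OF half, of "w k"] k_ge_1 by simp
  with s(2) have "extra_cost (space M) \<rho> t + w k / 4 \<le> extra_cost (space M) \<rho> (t @ s)"
    using extra_cost_append_ge[OF valid_next[OF s(1)] sets.top G] by simp
  then show ?thesis
    using Q(3) phase[OF _ s(1)] by (intro exI[of _ s] exI[of _ "S \<inter> Q"]) simp
qed

lemma phase_extra_cost:
  assumes U: "finite U" "card U = 2 * target_size (k - 1)"
    and h: "2 ^ h \<le> 2 * target_size (k - 1)" and \<rho>: "servable k U \<rho>" and "j \<le> h"
  shows "\<exists>t. \<exists>S\<subseteq>U. card S = 2 ^ (h - j) \<and> (\<forall>q\<in>S. phase D k U q j t) \<and>
    real j * w k / 4 \<le> extra_cost (space M) \<rho> t"
  using \<open>j \<le> h\<close>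
proof (induction j)
  case 0
  obtain S where "S \<subseteq> U" "card S = 2 ^ h"
    using obtain_subset_with_card_n[of "2 ^ h" U] U h by auto
  then show ?case by (intro exI[of _ "[]"] exI[of _ S]) (simp add: phase_0)
next
  case (Suc j)
  define c :: nat where "c = 2 ^ (h - Suc j)"
  obtain t S where S: "S \<subseteq> U" "card S = 2 ^ (h - j)"
    and t: "\<And>q. q \<in> S \<Longrightarrow> phase D k U q j t" "real j * w k / 4 \<le> extra_cost (space M) \<rho> t"
    using Suc.IH Suc.prems by auto
  have two_c: "2 * c = 2 ^ (h - j)"
    using Suc.prems by (simp add: c_def Suc_diff_Suc flip: power_Suc)
  also have "\<dots> \<le> 2 ^ h" by (intro power_increasing) auto
  finally have "c \<le> target_size (k - 1)" using h by linarith
  moreover have "0 < c" by (simp add: c_def)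
  ultimately obtain s S' where "S' \<subseteq> S" "card S' = c" "\<forall>q\<in>S'. phase D k U q (Suc j) (t @ s)"
    "extra_cost (space M) \<rho> t + w k / 4 \<le> extra_cost (space M) \<rho> (t @ s)"
    using phase_extend[OF U \<rho> S(1) _ _ _ t(1)] S(2) two_c by metis
  then show ?case
    using S(1) t(2) by (intro exI[of _ "t @ s"] exI[of _ S']) (auto simp: c_def field_simps)
qed

lemma phases_exist:
  assumes U: "finite U" "card U = 2 * target_size (k - 1)"
    and h: "2 ^ h \<le> 2 * target_size (k - 1)" and large: "real h * (2 + overhead (k - 1)) \<le> real D"
  shows "\<exists>\<rho>. servable k U \<rho> \<and> reveal_cost w \<rho> \<le> real n * (3 * w k) \<and>
    real n * (real h * w k / 4) \<le> expectation (\<lambda>A. cost A \<rho>)"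
proof (induction n)
  case 0
  show ?case
    by (intro exI[of _ "[]"]) (simp add: servable_Nil algorithm_cost_def moves_def)
next
  case (Suc n)
  then obtain \<rho> where \<rho>: "servable k U \<rho>" "reveal_cost w \<rho> \<le> real n * (3 * w k)"
    "real n * (real h * w k / 4) \<le> expectation (\<lambda>A. cost A \<rho>)" by blast
  obtain t S where "card S = 2 ^ (h - h)" "\<forall>q\<in>S. phase D k U q h t"
    and t: "real h * w k / 4 \<le> extra_cost (space M) \<rho> t"
    using phase_extra_cost[OF U h \<rho>(1) order.refl] by blast
  then obtain q where phase: "phase D k U q h t" by fastforce
  have servable: "servable k U (\<rho> @ t)"
    using servable_append_phase[OF \<rho>(1) phase] D_ge_2 k_ge_1 by simp
  moreover have "reveal_cost w (\<rho> @ t) \<le> real (Suc n) * (3 * w k)"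
    using \<rho>(2) phase_reveal_cost[OF phase D_ge_2 k_ge_1 large] by (simp add: algebra_simps)
  moreover have "real (Suc n) * (real h * w k / 4) \<le> expectation (\<lambda>A. cost A (\<rho> @ t))"
    using \<rho>(3) t extra_cost_space[OF servable_imp_valid_input[OF servable]]
    by (simp add: algebra_simps)
  ultimately show ?case by blast
qed

lemma competitive_ratio_ge_phase_length:
  assumes "finite U" "card U = 2 * target_size (k - 1)" "2 ^ h \<le> 2 * target_size (k - 1)"
    and "real h * (2 + overhead (k - 1)) \<le> real D" and "h \<ge> 1" and comp: "competitive k w U \<alpha> M"
  shows "real h / 12 \<le> \<alpha>"
proof -
  have "real h * w k / 4 \<le> \<alpha> * (3 * w k)"
  proof (rule competitive_ratio_ge[OF comp])
    show "0 < real h * w k / 4" using \<open>h \<ge> 1\<close> D_ge_2 by simp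
    fix n
    obtain \<rho> where \<rho>: "servable k U \<rho>" "reveal_cost w \<rho> \<le> real n * (3 * w k)"
      "real n * (real h * w k / 4) \<le> expectation (\<lambda>A. cost A \<rho>)"
      using phases_exist[OF assms(1-4)] by blast
    moreover have "pattern_cost k w (final_pattern \<rho>) \<le> reveal_cost w \<rho>"
      using servable_imp_valid_input[OF \<rho>(1)] by (rule pattern_cost_final_le_reveal_cost) simp
    ultimately show "\<exists>\<rho>. valid_input k U \<rho> \<and>
        pattern_cost k w (final_pattern \<rho>) \<le> real n * (3 * w k) \<and>
        real n * (real h * w k / 4) \<le> expectation (\<lambda>A. cost A \<rho>)"
      using servable_imp_valid_input order.trans by blast
  qed simp
  then show ?thesis using D_ge_2 by (simp add: field_simps)
qed

lemma competitive_ratio_ge_exponential: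
  assumes "finite U" "card U = 2 * target_size (k - 1)"
    and "2 ^ (k - 4) * (2 + overhead (k - 1)) \<le> real D" and "competitive k w U \<alpha> M"
  shows "1 / 192 * 2 ^ k \<le> \<alpha>"
proof -
  have "(2::real) ^ k \<le> 2 ^ (k - 4 + 4)" by (intro power_increasing) auto
  also have "\<dots> = 16 * real (2 ^ (k - 4))" by (simp add: power_add)
  moreover have "real (2 ^ (k - 4)) / 12 \<le> \<alpha>"
    using assms target_size_ge_double_exponential[of k]
    by (intro competitive_ratio_ge_phase_length) simp_all
  ultimately show ?thesis by simp
qed

end

theorem theorem3:
  shows "\<exists>c::real. c > 0 \<and> (\<forall>k::nat. k \<ge> 1 \<longrightarrow>
    (\<exists>(w :: nat \<Rightarrow> real) (U :: nat set).
       (\<forall>i\<in>{1..k}. w i > 0) \<and> mono_on {1..k} w \<and> finite U \<and> U \<noteq> {} \<and>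
       \<not> (\<exists>(M :: nat algorithm measure) (\<alpha> :: real).
            randomized_algorithm k U M \<and> competitive k w U \<alpha> M \<and> \<alpha> < c * 2 ^ k)))"
proof (rule exI[of _ "1 / 192"], intro conjI allI impI)
  fix k :: nat assume "k \<ge> 1"
  define D where "D = nat \<lceil>2 ^ (k - 4) * (2 + overhead (k - 1))\<rceil> + 2"
  let ?w = "\<lambda>i. real D ^ i" and ?U = "{..<2 * target_size (k - 1)}"
  have D: "D \<ge> 2" "2 ^ (k - 4) * (2 + overhead (k - 1)) \<le> real D"
    by (simp_all add: D_def) linarith
  then have w: "\<forall>i\<in>{1..k}. ?w i > 0" "mono_on {1..k} ?w"
    by (auto intro!: mono_onI power_increasing)
  have "1 / 192 * 2 ^ k \<le> \<alpha>" if "randomized_algorithm k ?U M" "competitive k ?w ?U \<alpha> M"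
    for M :: "nat algorithm measure" and \<alpha>
  proof -
    interpret geometric_server_algorithm k D ?U M
      by unfold_locales (use that(1) w(2) \<open>k \<ge> 1\<close> D(1) in auto)
    show ?thesis using D(2) that(2) by (intro competitive_ratio_ge_exponential) simp_all
  qed
  then have "\<not> (\<exists>(M :: nat algorithm measure) \<alpha>.
      randomized_algorithm k ?U M \<and> competitive k ?w ?U \<alpha> M \<and> \<alpha> < 1 / 192 * 2 ^ k)"
    by (meson not_le)
  moreover have "?U \<noteq> {}"
    using target_size_pos[of "k - 1"] by (auto simp: lessThan_empty_iff)
  ultimately show "\<exists>(w :: nat \<Rightarrow> real) (U :: nat set).
       (\<forall>i\<in>{1..k}. w i > 0) \<and> mono_on {1..k} w \<and> finite U \<and> U \<noteq> {} \<and>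
       \<not> (\<exists>(M :: nat algorithm measure) (\<alpha> :: real).
            randomized_algorithm k U M \<and> competitive k w U \<alpha> M \<and> \<alpha> < 1 / 192 * 2 ^ k)"
    using w by (intro exI[of _ ?w] exI[of _ ?U] conjI finite_lessThan)
qed simp

end
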